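(* Let $d,m\in\mathbb{N}$, let $\mathcal{X}\subseteq\mathbb{R}^d$ be a bounded domain, $\mathcal{Y}=\{-1,1\}$, $\mathcal{Z}=\mathcal{X}\times\mathcal{Y}$, and let $\rho$ be a probability distribution on $\mathcal{Z}$. Let ${\bf z}=\{z_i=(x_i,y_i): i=1,\dots,m\}$ be drawn i.i.d. from $\rho$. Fix a margin $r>0$, a regularization parameter $\lambda>0$, and a matrix norm $\|\cdot\|$ on $d\times d$ matrices. For a symmetric matrix $A\in\mathbb{S}^{d\times d}$ let $K_A(x,x')=x^TAx'$, $$\mathcal{E}_{\bf z}(A)=\frac1m\sum_{i=1}^m\Big(1-\frac{1}{mr}\sum_{j=1}^m y_iy_jK_A(x_i,x_j)\Big)_+,\qquad \mathcal{E}(A)=\int_{\mathcal{Z}}\Big(1-\frac1r\int_{\mathcal{Z}}yy'K_A(x,x')\,d\rho(x',y')\Big)_+d\rho(x,y),$$ and let $A_{\bf z}\in\arg\min_{A\in\mathbb{S}^{d\times d}}\big[\mathcal{E}_{\bf z}(A)+\lambda\|A\|\big]$. Then for any $0<\delta<1$, with probability at least $1-\delta$ over ${\bf z}$, $$\mathcal{E}_{\bf z}(A_{\bf z})-\mathcal{E}(A_{\bf z})\le \frac{6\mathcal{R}_m}{r\lambda}+\frac{2X_*}{r\lambda}\sqrt{\frac{2\ln(1/\delta)}{m}},$$ where $X_*=\sup_{x,x'\in\mathcal{X}}\|x'x^T\|_*$ and $\mathcal{R}_m=\mathbb{E}_{{\bf z},\sigma}\Big[\sup_{\tilde x\in\mathcal{X}}\Big\|\frac1m\sum_{i=1}^m\sigma_iy_ix_i\tilde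 x^T\Big\|_*\Big]$.
   Context: $(t)_+=\max(t,0)$. The dual norm of a matrix norm $\|\cdot\|$ is $\|B\|_*=\sup_{\|A\|\le1}\mathrm{trace}(B^TA)$. In $\mathcal{R}_m$, $\sigma_1,\dots,\sigma_m$ are i.i.d. Rademacher variables ($P(\sigma_i=1)=P(\sigma_i=-1)=1/2$) independent of ${\bf z}$, and the expectation is over both ${\bf z}$ and $\sigma$. $\mathbb{S}^{d\times d}$ denotes the symmetric $d\times d$ real matrices. *)

theory Defs
  imports "HOL-Analysis.Analysis" "HOL-Probability.Probability"
begin

definition pos_part :: "real \<Rightarrow> real" where
  "pos_part t = max t 0"

definition kerA :: "real^'d^'d \<Rightarrow> real^'d \<Rightarrow> real^'d \<Rightarrow> real" where
  "kerA A x x' = x \<bullet> (A *v x')"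

definition emp_err :: "real \<Rightarrow> nat \<Rightarrow> (nat \<Rightarrow> (real^'d) \<times> real) \<Rightarrow> real^'d^'d \<Rightarrow> real" where
  "emp_err r m z A = (1 / real m) * (\<Sum>i<m. pos_part (1 - (1 / (real m * r)) *
      (\<Sum>j<m. snd (z i) * snd (z j) * kerA A (fst (z i)) (fst (z j)))))"

definition exp_err :: "((real^'d) \<times> real) measure \<Rightarrow> real \<Rightarrow> real^'d^'d \<Rightarrow> real" where
  "exp_err \<rho> r A = (\<integral>z. pos_part (1 - (1 / r) *
      (\<integral>z'. snd z * snd z' * kerA A (fst z) (fst z') \<partial>\<rho>)) \<partial>\<rho>)"

definition is_matrix_norm :: "(real^'d^'d \<Rightarrow> real) \<Rightarrow> bool" where
  "is_matrix_norm N \<longleftrightarrow> (\<forall>A. N A \<ge> 0) \<and> (\<forall>A. N A = 0 \<longleftrightarrow> A = 0) \<and>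
     (\<forall>c A. N (c *\<^sub>R A) = \<bar>c\<bar> * N A) \<and> (\<forall>A B. N (A + B) \<le> N A + N B)"

definition dual_norm :: "(real^'d^'d \<Rightarrow> real) \<Rightarrow> real^'d^'d \<Rightarrow> real" where
  "dual_norm N B = Sup {trace (transpose B ** A) | A. N A \<le> 1}"

definition outer :: "real^'d \<Rightarrow> real^'d \<Rightarrow> real^'d^'d" where
  "outer u v = (\<chi> i j. u $ i * v $ j)"

definition X_star :: "(real^'d^'d \<Rightarrow> real) \<Rightarrow> (real^'d) set \<Rightarrow> real" where
  "X_star N X = Sup {dual_norm N (outer x' x) | x x'. x \<in> X \<and> x' \<in> X}"

definition sample_measure :: "nat \<Rightarrow> 'a measure \<Rightarrow> (nat \<Rightarrow> 'a) measure" where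
  "sample_measure m \<rho> = PiM {..<m} (\<lambda>_. \<rho>)"

text \<open>Rademacher-type complexity R_m: expectation over the sample z and over uniform
  Rademacher signs sigma in {-1,1}^m (written as an average over all 2^m sign vectors).\<close>
definition rad_complexity ::
  "((real^'d) \<times> real) measure \<Rightarrow> (real^'d^'d \<Rightarrow> real) \<Rightarrow> (real^'d) set \<Rightarrow> nat \<Rightarrow> real" where
  "rad_complexity \<rho> N X m = (\<integral>z. (\<Sum>\<sigma>\<in>({..<m} \<rightarrow>\<^sub>E {-1, 1::real}).
      Sup {dual_norm N (outer ((1 / real m) *\<^sub>R (\<Sum>i<m. (\<sigma> i * snd (z i)) *\<^sub>R fst (z i))) xt)
           | xt. xt \<in> X}) / 2 ^ m \<partial>(sample_measure m \<rho>))"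

end

theory Submission
  imports Defs
begin

text \<open>Comparing \<open>A\<^sub>z\<close> with the zero matrix gives \<open>lam * N A\<^sub>z \<le> 1\<close>, so it suffices to bound the one-sided
  uniform deviation of the empirical from the expected error over the symmetric matrices of norm
  at most \<open>1 / lam\<close>. On the support of the distribution the label enters only through \<open>u = y x\<close>, since
  \<open>y y' K\<^sub>A(x, x') = u\<^sup>T A u'\<close>. Replacing one sample point changes the deviation by at most
  \<open>4 X\<^sub>* / (m r lam)\<close>, so the bounded differences inequality yields the second summand. The expected deviation
  is split by replacing the inner average over the sample by the mean of \<open>u\<close>; both resulting
  terms are symmetrized, the second one after a contraction for the hinge function, and each costs
  \<open>2 R\<^sub>m / (r lam)\<close>.\<close>

section \<open>Bounded differences\<close>

text \<open>The empirical error is not an average of independent terms: every hinge contains an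
  average over the same sample. Bilinearity resolves this. The inner integral of the population
  error depends on the distribution only through one mean vector, and the effect of replacing it by
  the sample mean can be bounded uniformly over all possible first arguments, sample points
  included. Hence the first of the two processes is indexed by pairs of a matrix and a point. The
  suprema run over uncountable classes, so they are taken over countable dense subsets, where they
  are measurable, and carried over by continuity. As the bound holds for the whole class on one
  event, the minimizer \<open>Az\<close> is never treated as a random variable. The suprema are
  one-sided. The contraction thus avoids the extra factor 2 familiar from suprema of absolute
  values, and the proof reaches the constant 4, below the claimed 6. Absolute values, where
  required, come from closing the set of points under negation.\<close>

lemma integrable_bounded:
  fixes f :: "'a \<Rightarrow> real"
  assumes "prob_space M" "f \<in> borel_measurable M" "\<And>x. x \<in> space M \<Longrightarrow> \<bar>f x\<bar> \<le> B"
  shows "integrable M f"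
proof -
  interpret prob_space M by fact
  show ?thesis
    by (rule integrable_const_bound[of _ B]) (use assms in auto)
qed

lemma abs_integral_le_bound:
  fixes f :: "'a \<Rightarrow> real"
  assumes "prob_space M" "f \<in> borel_measurable M" "\<And>x. x \<in> space M \<Longrightarrow> \<bar>f x\<bar> \<le> B"
  shows "\<bar>\<integral>x. f x \<partial>M\<bar> \<le> B"
proof -
  interpret prob_space M by fact
  have "\<bar>\<integral>x. f x \<partial>M\<bar> \<le> (\<integral>x. \<bar>f x\<bar> \<partial>M)"
    by (rule integral_abs_bound)
  also have "\<dots> \<le> B"
    by (rule integral_le_const) (use integrable_bounded[OF assms] assms(3) in auto)
  finally show ?thesis .
qed

lemma fun_upd_in_space_PiM:
  "z \<in> space (PiM J (\<lambda>_. M)) \<Longrightarrow> x \<in> space M \<Longrightarrow> z(k := x) \<in> space (PiM (insert k J) (\<lambda>_. M))"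
  by (auto simp: space_PiM PiE_def extensional_def)

text \<open>Both orders are recorded because the symmetrization induction needs the new coordinate
  inside when that coordinate is symmetrized, and the old coordinates inside when the induction
  hypothesis is applied. The uniform bound supplies integrability for Fubini.\<close>

lemma integral_PiM_insert:
  fixes f :: "('i \<Rightarrow> 'a) \<Rightarrow> real"
  assumes M: "prob_space M" and J: "finite J" "k \<notin> J"
    and f [measurable]: "f \<in> borel_measurable (PiM (insert k J) (\<lambda>_. M))"
    and B: "\<And>z. z \<in> space (PiM (insert k J) (\<lambda>_. M)) \<Longrightarrow> \<bar>f z\<bar> \<le> B"
  shows "(\<integral>z. f z \<partial>PiM (insert k J) (\<lambda>_. M)) = (\<integral>z. \<integral>x. f (z(k := x)) \<partial>M \<partial>PiM J (\<lambda>_. M))"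
    and "(\<integral>z. f z \<partial>PiM (insert k J) (\<lambda>_. M)) = (\<integral>x. \<integral>z. f (z(k := x)) \<partial>PiM J (\<lambda>_. M) \<partial>M)"
proof -
  interpret M: prob_space M by fact
  interpret product_prob_space "\<lambda>_. M" J by unfold_locales
  interpret PP: pair_prob_space "PiM J (\<lambda>_. M)" M by unfold_locales
  have int: "integrable (PiM (insert k J) (\<lambda>_. M)) f"
    by (rule integrable_bounded[OF prob_space_PiM[OF M] f B])
  show first: "(\<integral>z. f z \<partial>PiM (insert k J) (\<lambda>_. M)) = (\<integral>z. \<integral>x. f (z(k := x)) \<partial>M \<partial>PiM J (\<lambda>_. M))"
    by (rule product_integral_insert[OF J int])
  have "integrable (PiM J (\<lambda>_. M) \<Otimes>\<^sub>M M) (\<lambda>(z, x). f (z(k := x)))"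
    by (rule integrable_bounded[where B = B])
      (auto simp: space_pair_measure PP.P.prob_space_axioms intro!: B fun_upd_in_space_PiM)
  then show "(\<integral>z. f z \<partial>PiM (insert k J) (\<lambda>_. M)) = (\<integral>x. \<integral>z. f (z(k := x)) \<partial>PiM J (\<lambda>_. M) \<partial>M)"
    unfolding first by (rule PP.Fubini_integral [symmetric])
qed

text \<open>Averaging over the new coordinate \<open>k\<close> gives a function \<open>G\<close> of
  the old ones that inherits the difference bound, so the induction hypothesis applies to it. For
  fixed old coordinates, \<open>F - G\<close> is centered and ranges in an interval of length
  \<open>c\<close>; Hoeffding's lemma then contributes one factor
  \<open>exp (s\<^sup>2 * c\<^sup>2 / 8)\<close>.\<close>

lemma exp_moment_bounded_differences:
  fixes F :: "('i \<Rightarrow> 'a) \<Rightarrow> real"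
  assumes M: "prob_space M" and I: "finite I" and s: "s > 0"
    and "F \<in> borel_measurable (PiM I (\<lambda>_. M))"
    and "\<And>z. z \<in> space (PiM I (\<lambda>_. M)) \<Longrightarrow> \<bar>F z\<bar> \<le> B"
    and "\<And>z k x. z \<in> space (PiM I (\<lambda>_. M)) \<Longrightarrow> k \<in> I \<Longrightarrow> x \<in> space M \<Longrightarrow> F (z(k := x)) - F z \<le> c"
  shows "(\<integral>z. exp (s * (F z - (\<integral>z. F z \<partial>PiM I (\<lambda>_. M)))) \<partial>PiM I (\<lambda>_. M))
    \<le> exp (real (card I) * (s\<^sup>2 * c\<^sup>2 / 8))"
  using I assms(4-)
proof (induction I arbitrary: F rule: finite_induct)
  case empty
  show ?case by (simp add: PiM_empty lebesgue_integral_count_space_finite)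
next
  case (insert k J)
  interpret M: prob_space M by fact
  interpret product_prob_space "\<lambda>_. M" J by unfold_locales
  note F [measurable] = insert.prems(1)
  note B = insert.prems(2) and diff = insert.prems(3)
  define G where "G z = (\<integral>x. F (z(k := x)) \<partial>M)" for z
  define \<mu> where "\<mu> = (\<integral>z. F z \<partial>PiM (insert k J) (\<lambda>_. M))"
  have upd: "(\<lambda>x. F (z(k := x))) \<in> borel_measurable M" if "z \<in> space (PiM J (\<lambda>_. M))" for z
    using measurable_compose[OF measurable_component_update[OF that insert.hyps(2)] F] .
  have G [measurable]: "G \<in> borel_measurable (PiM J (\<lambda>_. M))"
    unfolding G_def by measurable
  have bG: "\<bar>G z\<bar> \<le> B" if "z \<in> space (PiM J (\<lambda>_. M))" for z
    unfolding G_def using that B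
    by (intro abs_integral_le_bound[OF M upd]) (auto intro!: B fun_upd_in_space_PiM)
  have \<mu>: "\<mu> = (\<integral>z. G z \<partial>PiM J (\<lambda>_. M))"
    unfolding \<mu>_def G_def by (rule integral_PiM_insert[OF M insert.hyps F B])
  have b\<mu>: "\<bar>\<mu>\<bar> \<le> B"
    unfolding \<mu>_def by (intro abs_integral_le_bound[OF prob_space_PiM[OF M]] F B)
  have bexp: "\<bar>exp (s * (a - b))\<bar> \<le> exp (s * (2 * B))" if "\<bar>a\<bar> \<le> B" "\<bar>b\<bar> \<le> B" for a b
    using that s by (auto intro!: mult_left_mono)
  have diffG: "G (z(i := x)) - G z \<le> c"
    if z: "z \<in> space (PiM J (\<lambda>_. M))" and i: "i \<in> J" and x: "x \<in> space M" for z i x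
  proof -
    have zi: "z(i := x) \<in> space (PiM J (\<lambda>_. M))"
      using fun_upd_in_space_PiM[OF z x, of i] i by (simp add: insert_absorb)
    have "integrable M (\<lambda>y. F (z(k := y)))" "integrable M (\<lambda>y. F ((z(i := x))(k := y)))"
      using z zi by (auto intro!: integrable_bounded[OF M upd] B fun_upd_in_space_PiM)
    note int = this
    have "G (z(i := x)) - G z = (\<integral>y. F ((z(i := x))(k := y)) - F (z(k := y)) \<partial>M)"
      unfolding G_def using int by simp
    also have "\<dots> \<le> c"
    proof (rule M.integral_le_const)
      show "AE y in M. F ((z(i := x))(k := y)) - F (z(k := y)) \<le> c"
      proof (rule AE_I2)
        fix y assume y: "y \<in> space M"
        have "k \<noteq> i" using i insert.hyps by auto
        then have eq: "(z(i := x))(k := y) = (z(k := y))(i := x)"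
          by (auto simp: fun_eq_iff)
        show "F ((z(i := x))(k := y)) - F (z(k := y)) \<le> c"
          unfolding eq by (rule diff[OF fun_upd_in_space_PiM[OF z y] _ x]) (use i in auto)
      qed
    qed (use int in auto)
    finally show ?thesis .
  qed
  have inner: "(\<integral>x. exp (s * (F (z(k := x)) - G z)) \<partial>M) \<le> exp (s\<^sup>2 * c\<^sup>2 / 8)"
    if z: "z \<in> space (PiM J (\<lambda>_. M))" for z
  proof -
    \<comment> \<open>A one-sided difference bound is enough for an interval of length
      \<open>c\<close>: it holds for every ordered pair of values of the coordinate, so no value
      exceeds the infimum by more than \<open>c\<close>.\<close>
    define l where "l = (INF x\<in>space M. F (z(k := x)))"
    have bd: "bdd_below ((\<lambda>x. F (z(k := x))) ` space M)"
    proof (rule bdd_belowI2)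
      show "- B \<le> F (z(k := x))" if "x \<in> space M" for x
        using abs_le_D2[OF B[OF fun_upd_in_space_PiM[OF z that]]] by linarith
    qed
    interpret interval_bounded_random_variable M "\<lambda>x. F (z(k := x))" l "l + c"
    proof
      show "(\<lambda>x. F (z(k := x))) \<in> borel_measurable M" by (rule upd[OF z])
      show "AE x in M. F (z(k := x)) \<in> {l..l + c}"
      proof (rule AE_I2)
        fix x assume x: "x \<in> space M"
        have "F (z(k := x)) - c \<le> l"
          unfolding l_def
        proof (rule cINF_greatest)
          show "space M \<noteq> {}" using x by auto
          show "F (z(k := x)) - c \<le> F (z(k := y))" if "y \<in> space M" for y
            using diff[OF fun_upd_in_space_PiM[OF z that] insertI1 x, unfolded fun_upd_upd] by linarith
        qed
        moreover have "l \<le> F (z(k := x))"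
          unfolding l_def by (rule cINF_lower[OF bd x])
        ultimately show "F (z(k := x)) \<in> {l..l + c}" by simp
      qed
    qed
    have "integrable M (\<lambda>x. exp (s * (F (z(k := x)) - G z)))"
    proof (rule integrable_bounded[OF M])
      show "(\<lambda>x. exp (s * (F (z(k := x)) - G z))) \<in> borel_measurable M"
        using upd[OF z] by measurable
      show "\<bar>exp (s * (F (z(k := x)) - G z))\<bar> \<le> exp (s * (2 * B))" if "x \<in> space M" for x
        by (rule bexp[OF B[OF fun_upd_in_space_PiM[OF z that]] bG[OF z]])
    qed
    then have "ennreal (\<integral>x. exp (s * (F (z(k := x)) - G z)) \<partial>M)
        = (\<integral>\<^sup>+x. exp (s * (F (z(k := x)) - G z)) \<partial>M)"
      by (subst nn_integral_eq_integral) auto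
    also have "\<dots> \<le> ennreal (exp (s\<^sup>2 * c\<^sup>2 / 8))"
      using Hoeffdings_lemma_nn_integral[OF s] by (simp add: G_def)
    finally show ?thesis by simp
  qed
  have "(\<integral>z. exp (s * (F z - \<mu>)) \<partial>PiM (insert k J) (\<lambda>_. M))
      = (\<integral>z. (\<integral>x. exp (s * (F (z(k := x)) - \<mu>)) \<partial>M) \<partial>PiM J (\<lambda>_. M))"
    by (rule integral_PiM_insert(1)[OF M insert.hyps]) (measurable, rule bexp[OF B b\<mu>])
  also have "\<dots> \<le> (\<integral>z. exp (s\<^sup>2 * c\<^sup>2 / 8) * exp (s * (G z - \<mu>)) \<partial>PiM J (\<lambda>_. M))"
  proof (rule integral_mono)
    show "integrable (PiM J (\<lambda>_. M)) (\<lambda>z. \<integral>x. exp (s * (F (z(k := x)) - \<mu>)) \<partial>M)"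
    proof (rule integrable_bounded[OF prob_space_PiM[OF M]])
      fix z assume z: "z \<in> space (PiM J (\<lambda>_. M))"
      show "\<bar>\<integral>x. exp (s * (F (z(k := x)) - \<mu>)) \<partial>M\<bar> \<le> exp (s * (2 * B))"
      proof (rule abs_integral_le_bound[OF M])
        show "(\<lambda>x. exp (s * (F (z(k := x)) - \<mu>))) \<in> borel_measurable M"
          using upd[OF z] by measurable
        show "\<bar>exp (s * (F (z(k := x)) - \<mu>))\<bar> \<le> exp (s * (2 * B))" if "x \<in> space M" for x
          by (rule bexp[OF B[OF fun_upd_in_space_PiM[OF z that]] b\<mu>])
      qed
    qed measurable
    show "integrable (PiM J (\<lambda>_. M)) (\<lambda>z. exp (s\<^sup>2 * c\<^sup>2 / 8) * exp (s * (G z - \<mu>)))"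
      by (rule integrable_mult_right, rule integrable_bounded[OF prob_space_PiM[OF M]])
        (measurable, rule bexp[OF bG b\<mu>])
    fix z assume z: "z \<in> space (PiM J (\<lambda>_. M))"
    \<comment> \<open>The second factor does not depend on \<open>x\<close>, so it leaves the inner
      integral and only the centered part is left to Hoeffding's lemma.\<close>
    have "exp (s * (F (z(k := x)) - \<mu>)) = exp (s * (F (z(k := x)) - G z)) * exp (s * (G z - \<mu>))" for x
      by (simp add: exp_add[symmetric] algebra_simps)
    then have "(\<integral>x. exp (s * (F (z(k := x)) - \<mu>)) \<partial>M)
        = (\<integral>x. exp (s * (F (z(k := x)) - G z)) \<partial>M) * exp (s * (G z - \<mu>))"
      by simp
    then show "(\<integral>x. exp (s * (F (z(k := x)) - \<mu>)) \<partial>M) \<le> exp (s\<^sup>2 * c\<^sup>2 / 8) * exp (s * (G z - \<mu>))"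
      using inner[OF z] by (simp add: mult_right_mono)
  qed
  also have "\<dots> = exp (s\<^sup>2 * c\<^sup>2 / 8) * (\<integral>z. exp (s * (G z - \<mu>)) \<partial>PiM J (\<lambda>_. M))"
    by simp
  also have "\<dots> \<le> exp (s\<^sup>2 * c\<^sup>2 / 8) * exp (real (card J) * (s\<^sup>2 * c\<^sup>2 / 8))"
    unfolding \<mu> by (intro mult_left_mono insert.IH G bG diffG) auto
  also have "\<dots> = exp (real (card (insert k J)) * (s\<^sup>2 * c\<^sup>2 / 8))"
    using insert.hyps by (simp add: exp_add[symmetric] algebra_simps)
  finally show ?case unfolding \<mu>_def .
qed

theorem bounded_differences_inequality:
  fixes F :: "('i \<Rightarrow> 'a) \<Rightarrow> real"
  assumes M: "prob_space M" and I: "finite I" "I \<noteq> {}" and c: "c > 0" and t: "t > 0"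
    and F [measurable]: "F \<in> borel_measurable (PiM I (\<lambda>_. M))"
    and B: "\<And>z. z \<in> space (PiM I (\<lambda>_. M)) \<Longrightarrow> \<bar>F z\<bar> \<le> B"
    and diff: "\<And>z k x. z \<in> space (PiM I (\<lambda>_. M)) \<Longrightarrow> k \<in> I \<Longrightarrow> x \<in> space M \<Longrightarrow> F (z(k := x)) - F z \<le> c"
  shows "measure (PiM I (\<lambda>_. M))
      {z \<in> space (PiM I (\<lambda>_. M)). F z \<ge> (\<integral>z. F z \<partial>PiM I (\<lambda>_. M)) + t}
    \<le> exp (- 2 * t\<^sup>2 / (real (card I) * c\<^sup>2))"
proof -
  interpret P: prob_space "PiM I (\<lambda>_. M)" by (rule prob_space_PiM[OF M])
  define \<mu> where "\<mu> = (\<integral>z. F z \<partial>PiM I (\<lambda>_. M))"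
  define n where "n = real (card I)"
  have n: "n > 0" using I by (simp add: n_def card_gt_0_iff)
  \<comment> \<open>The minimizer of the Chernoff exponent
    \<open>n * (s\<^sup>2 * c\<^sup>2 / 8) - s * t\<close>.\<close>
  define s where "s = 4 * t / (n * c\<^sup>2)"
  have s: "s > 0" using t n c by (simp add: s_def)
  have b\<mu>: "\<bar>\<mu>\<bar> \<le> B"
    unfolding \<mu>_def by (intro abs_integral_le_bound[OF prob_space_PiM[OF M]] F B)
  have int: "integrable (PiM I (\<lambda>_. M)) (\<lambda>z. exp (s * (F z - \<mu>)))"
  proof (rule integrable_bounded[OF prob_space_PiM[OF M]])
    show "\<bar>exp (s * (F z - \<mu>))\<bar> \<le> exp (s * (2 * B))" if "z \<in> space (PiM I (\<lambda>_. M))" for z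
      using B[OF that] b\<mu> s by (auto intro!: mult_left_mono)
  qed simp
  have "P.prob {z \<in> space (PiM I (\<lambda>_. M)). F z \<ge> \<mu> + t}
      = P.prob {z \<in> space (PiM I (\<lambda>_. M)). exp (s * (F z - \<mu>)) \<ge> exp (s * t)}"
    using s by (intro arg_cong[where f = P.prob]) auto
  also have "\<dots> \<le> (\<integral>z. exp (s * (F z - \<mu>)) \<partial>PiM I (\<lambda>_. M)) / exp (s * t)"
    by (rule integral_Markov_inequality_measure[OF int, where A = "{}"]) auto
  also have "\<dots> \<le> exp (n * (s\<^sup>2 * c\<^sup>2 / 8)) / exp (s * t)"
    unfolding \<mu>_def n_def using diff
    by (intro divide_right_mono exp_moment_bounded_differences[OF M I(1) s F B]) auto
  also have "\<dots> = exp (n * (s\<^sup>2 * c\<^sup>2 / 8) - s * t)"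
    by (simp add: exp_diff)
  also have "n * (s\<^sup>2 * c\<^sup>2 / 8) - s * t = - 2 * t\<^sup>2 / (n * c\<^sup>2)"
    using n c by (simp add: s_def field_simps power2_eq_square)
  finally show ?thesis unfolding \<mu>_def n_def .
qed

section \<open>Symmetrization and contraction\<close>

lemma abs_cSUP_le:
  fixes g :: "'c \<Rightarrow> real"
  assumes "D \<noteq> {}" "\<And>a. a \<in> D \<Longrightarrow> \<bar>g a\<bar> \<le> B"
  shows "\<bar>SUP a\<in>D. g a\<bar> \<le> B"
  by (rule cSup_abs_le) (use assms in auto)

lemma bdd_above_abs:
  fixes g :: "'c \<Rightarrow> real"
  assumes "\<And>a. a \<in> D \<Longrightarrow> \<bar>g a\<bar> \<le> B"
  shows "bdd_above (g ` D)"
  using assms by (auto intro!: bdd_aboveI[of _ B] simp: abs_le_iff)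

lemma cSUP_measurable_bounded:
  fixes g :: "'c \<Rightarrow> 'a \<Rightarrow> real"
  assumes "countable D" "\<And>a. a \<in> D \<Longrightarrow> g a \<in> borel_measurable M"
    and "\<And>a x. a \<in> D \<Longrightarrow> x \<in> space M \<Longrightarrow> \<bar>g a x\<bar> \<le> B"
  shows "(\<lambda>x. SUP a\<in>D. g a x) \<in> borel_measurable M"
  using assms by (intro borel_measurable_cSUP bdd_above_abs) auto

text \<open>For a fixed pair \<open>a\<close>, \<open>b\<close> the left side contributes
  \<open>h a + h b + 2 * (\<phi> (t a) - \<phi> (t b))\<close>, and the Lipschitz bound replaces the
  difference by \<open>\<bar>t a - t b\<bar>\<close>. Whatever the sign of \<open>t a - t b\<close>,
  the result is a term of the first right-hand supremum plus a term of the second.\<close>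

lemma cSUP_contraction:
  fixes h t :: "'c \<Rightarrow> real" and \<phi> :: "real \<Rightarrow> real"
  assumes D: "D \<noteq> {}" and h: "\<And>a. a \<in> D \<Longrightarrow> \<bar>h a\<bar> \<le> C" and t: "\<And>a. a \<in> D \<Longrightarrow> \<bar>t a\<bar> \<le> B"
    and \<phi>: "1-lipschitz_on UNIV \<phi>"
  shows "(SUP a\<in>D. h a + 2 * \<phi> (t a)) + (SUP a\<in>D. h a - 2 * \<phi> (t a))
    \<le> (SUP a\<in>D. h a + 2 * t a) + (SUP a\<in>D. h a - 2 * t a)" (is "?P + ?Q \<le> ?R + ?S")
proof -
  have b: "\<bar>h a + 2 * t a\<bar> \<le> C + 2 * B" "\<bar>h a - 2 * t a\<bar> \<le> C + 2 * B" if "a \<in> D" for a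
    using h[OF that] t[OF that] by linarith+
  have "bdd_above ((\<lambda>a. h a + 2 * t a) ` D)" "bdd_above ((\<lambda>a. h a - 2 * t a) ` D)"
    by (rule bdd_above_abs, rule b, assumption)+
  then have R: "h a + 2 * t a \<le> ?R" and S: "h a - 2 * t a \<le> ?S" if "a \<in> D" for a
    using that by (auto intro!: cSUP_upper)
  have "?P \<le> ?R + ?S - ?Q"
  proof (rule cSUP_least[OF D])
    fix a assume a: "a \<in> D"
    have "?Q \<le> ?R + ?S - (h a + 2 * \<phi> (t a))"
    proof (rule cSUP_least[OF D])
      fix b assume b: "b \<in> D"
      have "\<bar>\<phi> (t a) - \<phi> (t b)\<bar> \<le> \<bar>t a - t b\<bar>"
        using lipschitz_onD[OF \<phi>, of "t a" "t b"] by (simp add: dist_real_def)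
      \<comment> \<open>Both assignments of \<open>a\<close> and \<open>b\<close> to the two suprema
        are supplied, one for each sign of \<open>t a - t b\<close>.\<close>
      then show "h b - 2 * \<phi> (t b) \<le> ?R + ?S - (h a + 2 * \<phi> (t a))"
        using R[OF a] S[OF a] R[OF b] S[OF b] by linarith
    qed
    then show "h a + 2 * \<phi> (t a) \<le> ?R + ?S - ?Q" by simp
  qed
  then show ?thesis by simp
qed

text \<open>The summand \<open>h a + (\<phi> (f a x) - e a)\<close> is the midpoint of
  \<open>h a + 2 * \<phi> (f a x)\<close> and \<open>h a - 2 * e a\<close>, where \<open>e a\<close>
  is the mean. The supremum of the second term is at most the mean of the supremum of
  \<open>h a - 2 * \<phi> (f a x)\<close>, which takes the place of an independent copy and explains
  the factor 2. The contraction is then applied separately at each \<open>x\<close>.\<close>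

lemma symmetrization_step:
  fixes f :: "'c \<Rightarrow> 'a \<Rightarrow> real" and \<phi> :: "real \<Rightarrow> real"
  assumes M: "prob_space M" and D: "countable D" "D \<noteq> {}"
    and f: "\<And>a. a \<in> D \<Longrightarrow> f a \<in> borel_measurable M"
    and B: "\<And>a x. a \<in> D \<Longrightarrow> x \<in> space M \<Longrightarrow> \<bar>f a x\<bar> \<le> B"
    and \<phi>: "1-lipschitz_on UNIV \<phi>"
    and h: "\<And>a. a \<in> D \<Longrightarrow> \<bar>h a\<bar> \<le> C"
  shows "(\<integral>x. (SUP a\<in>D. h a + (\<phi> (f a x) - (\<integral>y. \<phi> (f a y) \<partial>M))) \<partial>M)
    \<le> (\<integral>x. ((SUP a\<in>D. h a + 2 * f a x) + (SUP a\<in>D. h a - 2 * f a x)) / 2 \<partial>M)"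
proof -
  interpret prob_space M by fact
  define B' where "B' = \<bar>\<phi> 0\<bar> + B"
  have \<phi>m [measurable]: "\<phi> \<in> borel_measurable borel"
    by (intro borel_measurable_continuous_onI lipschitz_on_continuous_on[OF \<phi>])
  have \<phi>f: "(\<lambda>x. \<phi> (f a x)) \<in> borel_measurable M" if "a \<in> D" for a
    using f[OF that] by measurable
  have B': "\<bar>\<phi> (f a x)\<bar> \<le> B'" if "a \<in> D" "x \<in> space M" for a x
  proof -
    have "\<bar>\<phi> (f a x) - \<phi> 0\<bar> \<le> \<bar>f a x\<bar>"
      using lipschitz_onD[OF \<phi>, of "f a x" 0] by (simp add: dist_real_def)
    then show ?thesis using B[OF that] unfolding B'_def by linarith
  qed
  define e where "e a = (\<integral>y. \<phi> (f a y) \<partial>M)" for a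
  have e: "\<bar>e a\<bar> \<le> B'" if "a \<in> D" for a
    unfolding e_def by (rule abs_integral_le_bound[OF M \<phi>f[OF that] B'[OF that]])
  have b\<phi>: "\<bar>h a + 2 * \<phi> (f a x)\<bar> \<le> C + 2 * B'" "\<bar>h a - 2 * \<phi> (f a x)\<bar> \<le> C + 2 * B'"
    "\<bar>h a + (\<phi> (f a x) - e a)\<bar> \<le> C + 2 * B'"
    if "a \<in> D" "x \<in> space M" for a x
    using h[OF that(1)] B'[OF that] e[OF that(1)] by linarith+
  have bf: "\<bar>h a + 2 * f a x\<bar> \<le> C + 2 * B" "\<bar>h a - 2 * f a x\<bar> \<le> C + 2 * B"
    if "a \<in> D" "x \<in> space M" for a x
    using h[OF that(1)] B[OF that] by linarith+
  have intI: "integrable M (\<lambda>x. SUP a\<in>D. g a x)"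
    if "\<And>a. a \<in> D \<Longrightarrow> g a \<in> borel_measurable M"
      "\<And>a x. a \<in> D \<Longrightarrow> x \<in> space M \<Longrightarrow> \<bar>g a x\<bar> \<le> K" for g :: "'c \<Rightarrow> 'a \<Rightarrow> real" and K
  proof (rule integrable_bounded[OF M])
    show "(\<lambda>x. SUP a\<in>D. g a x) \<in> borel_measurable M"
      by (rule cSUP_measurable_bounded[OF D(1)]) (fact that)+
    show "\<bar>SUP a\<in>D. g a x\<bar> \<le> K" if "x \<in> space M" for x
      by (rule abs_cSUP_le[OF D(2)]) (rule \<open>\<And>a x. a \<in> D \<Longrightarrow> x \<in> space M \<Longrightarrow> \<bar>g a x\<bar> \<le> K\<close>[OF _ that])
  qed
  have int:
    "integrable M (\<lambda>x. SUP a\<in>D. h a + 2 * \<phi> (f a x))"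
    "integrable M (\<lambda>x. SUP a\<in>D. h a - 2 * \<phi> (f a x))"
    "integrable M (\<lambda>x. SUP a\<in>D. h a + (\<phi> (f a x) - e a))"
    by (rule intI[of _ "C + 2 * B'"]; use b\<phi> \<phi>f in auto)+
  have int':
    "integrable M (\<lambda>x. SUP a\<in>D. h a + 2 * f a x)" "integrable M (\<lambda>x. SUP a\<in>D. h a - 2 * f a x)"
    by (rule intI[of _ "C + 2 * B"]; use bf f in auto)+
  \<comment> \<open>The supremum over \<open>a\<close> of the means \<open>h a - 2 * e a\<close> is
    at most this mean of the suprema, as in Jensen's inequality.\<close>
  define K where "K = (\<integral>x. (SUP a\<in>D. h a - 2 * \<phi> (f a x)) \<partial>M)"
  have K: "h a - 2 * e a \<le> K" if a: "a \<in> D" for a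
  proof -
    have ia: "integrable M (\<lambda>x. \<phi> (f a x))"
      by (rule integrable_bounded[OF M \<phi>f[OF a] B'[OF a]])
    then have "h a - 2 * e a = (\<integral>x. h a - 2 * \<phi> (f a x) \<partial>M)"
      unfolding e_def by (simp add: prob_space)
    also have "\<dots> \<le> K"
      unfolding K_def
    proof (rule integral_mono)
      show "h a - 2 * \<phi> (f a x) \<le> (SUP a\<in>D. h a - 2 * \<phi> (f a x))" if "x \<in> space M" for x
        by (rule cSUP_upper[OF a bdd_above_abs]) (rule b\<phi>(2)[OF _ that])
    qed (use ia int(2) in auto)
    finally show ?thesis .
  qed
  have "(\<integral>x. (SUP a\<in>D. h a + (\<phi> (f a x) - e a)) \<partial>M)
      \<le> (\<integral>x. ((SUP a\<in>D. h a + 2 * \<phi> (f a x)) + K) / 2 \<partial>M)"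
  proof (rule integral_mono)
    fix x assume x: "x \<in> space M"
    show "(SUP a\<in>D. h a + (\<phi> (f a x) - e a)) \<le> ((SUP a\<in>D. h a + 2 * \<phi> (f a x)) + K) / 2"
    proof (rule cSUP_least[OF D(2)])
      fix a assume a: "a \<in> D"
      have "h a + 2 * \<phi> (f a x) \<le> (SUP a\<in>D. h a + 2 * \<phi> (f a x))"
        by (rule cSUP_upper[OF a bdd_above_abs]) (rule b\<phi>(1)[OF _ x])
      then have "(h a + 2 * \<phi> (f a x)) + (h a - 2 * e a) \<le> (SUP a\<in>D. h a + 2 * \<phi> (f a x)) + K"
        by (rule add_mono[OF _ K[OF a]])
      then show "h a + (\<phi> (f a x) - e a) \<le> ((SUP a\<in>D. h a + 2 * \<phi> (f a x)) + K) / 2"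
        by (simp add: field_simps)
    qed
  qed (use int in auto)
  also have "\<dots> = (\<integral>x. ((SUP a\<in>D. h a + 2 * \<phi> (f a x)) + (SUP a\<in>D. h a - 2 * \<phi> (f a x))) / 2 \<partial>M)"
    using int by (simp add: K_def prob_space)
  also have "\<dots> \<le> (\<integral>x. ((SUP a\<in>D. h a + 2 * f a x) + (SUP a\<in>D. h a - 2 * f a x)) / 2 \<partial>M)"
  proof (rule integral_mono)
    show "((SUP a\<in>D. h a + 2 * \<phi> (f a x)) + (SUP a\<in>D. h a - 2 * \<phi> (f a x))) / 2
        \<le> ((SUP a\<in>D. h a + 2 * f a x) + (SUP a\<in>D. h a - 2 * f a x)) / 2" if "x \<in> space M" for x
      by (intro divide_right_mono cSUP_contraction[OF D(2) h B \<phi>]) (use that in auto)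
  qed (use int int' in auto)
  finally show ?thesis unfolding e_def .
qed

lemma sum_signs_insert:
  fixes g :: "('i \<Rightarrow> real) \<Rightarrow> real"
  assumes "finite J" "k \<notin> J"
  shows "(\<Sum>\<sigma>\<in>insert k J \<rightarrow>\<^sub>E {-1, 1::real}. g \<sigma>)
    = (\<Sum>\<sigma>\<in>J \<rightarrow>\<^sub>E {-1, 1}. g (\<sigma>(k := 1)) + g (\<sigma>(k := -1)))"
proof -
  have "(\<Sum>\<sigma>\<in>insert k J \<rightarrow>\<^sub>E {-1, 1::real}. g \<sigma>)
      = (\<Sum>(y, \<sigma>)\<in>{-1, 1} \<times> (J \<rightarrow>\<^sub>E {-1, 1}). g (\<sigma>(k := y)))"
    unfolding PiE_insert_eq 
    by (subst sum.reindex[OF inj_combinator[OF assms(2)]]) (simp add: case_prod_unfold)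
  also have "\<dots> = (\<Sum>y\<in>{-1, 1}. \<Sum>\<sigma>\<in>J \<rightarrow>\<^sub>E {-1, 1}. g (\<sigma>(k := y)))"
    by (rule sum.cartesian_product[symmetric])
  also have "\<dots> = (\<Sum>\<sigma>\<in>J \<rightarrow>\<^sub>E {-1, 1}. g (\<sigma>(k := 1)) + g (\<sigma>(k := -1)))"
    by (simp add: sum.distrib)
  finally show ?thesis .
qed

text \<open>The induction treats one coordinate at a time by \<open>symmetrization_step\<close>, with the terms of the
  other coordinates absorbed into the offset \<open>h\<close>; this needs no ghost sample.\<close>

theorem symmetrization_contraction:
  fixes f :: "'c \<Rightarrow> 'a \<Rightarrow> real" and \<phi> :: "real \<Rightarrow> real"
  assumes M: "prob_space M" and I: "finite (I :: 'i set)" and D: "countable D" "D \<noteq> {}"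
    and f: "\<And>a. a \<in> D \<Longrightarrow> f a \<in> borel_measurable M"
    and B: "\<And>a x. a \<in> D \<Longrightarrow> x \<in> space M \<Longrightarrow> \<bar>f a x\<bar> \<le> B"
    and \<phi>: "1-lipschitz_on UNIV \<phi>"
    and "\<And>a. a \<in> D \<Longrightarrow> \<bar>h a\<bar> \<le> C"
  shows "(\<integral>z. (SUP a\<in>D. h a + (\<Sum>i\<in>I. \<phi> (f a (z i)) - (\<integral>x. \<phi> (f a x) \<partial>M))) \<partial>PiM I (\<lambda>_. M))
    \<le> (\<integral>z. (\<Sum>\<sigma>\<in>I \<rightarrow>\<^sub>E {-1, 1}. SUP a\<in>D. h a + 2 * (\<Sum>i\<in>I. \<sigma> i * f a (z i))) / 2 ^ card I
        \<partial>PiM I (\<lambda>_. M))"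
  using I assms(8)
proof (induction I arbitrary: h C rule: finite_induct)
  case empty
  show ?case by (simp add: PiM_empty lebesgue_integral_count_space_finite)
next
  case (insert k J)
  note h = insert.prems
  note PM = prob_space_PiM[OF M]
  let ?PJ = "PiM J (\<lambda>_. M)" and ?PI = "PiM (insert k J) (\<lambda>_. M)"
  interpret M: prob_space M by fact
  define e where "e a = (\<integral>x. \<phi> (f a x) \<partial>M)" for a
  define B' where "B' = \<bar>\<phi> 0\<bar> + B"
  have \<phi>m [measurable]: "\<phi> \<in> borel_measurable borel"
    by (intro borel_measurable_continuous_onI lipschitz_on_continuous_on[OF \<phi>])
  have B': "\<bar>\<phi> (f a x)\<bar> \<le> B'" if "a \<in> D" "x \<in> space M" for a x
  proof -
    have "\<bar>\<phi> (f a x) - \<phi> 0\<bar> \<le> \<bar>f a x\<bar>"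
      using lipschitz_onD[OF \<phi>, of "f a x" 0] by (simp add: dist_real_def)
    then show ?thesis using B[OF that] unfolding B'_def by linarith
  qed
  have e: "\<bar>e a\<bar> \<le> B'" if "a \<in> D" for a
    unfolding e_def using f[OF that] by (intro abs_integral_le_bound[OF M _ B'[OF that]]) measurable
  have diffB: "\<bar>\<phi> (f a x) - e a\<bar> \<le> 2 * B'" if "a \<in> D" "x \<in> space M" for a x
    using B'[OF that] e[OF that(1)] by linarith
  define S where "S K a z = (\<Sum>i\<in>K. \<phi> (f a (z i)) - e a)" for K :: "'i set" and a z
  have comp: "z i \<in> space M" if "z \<in> space (PiM K (\<lambda>_. M))" "i \<in> K" for z K and i :: 'i
    using that by (auto simp: space_PiM)
  have SB: "\<bar>S K a z\<bar> \<le> real (card K) * (2 * B')"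
    if "a \<in> D" "\<And>i. i \<in> K \<Longrightarrow> z i \<in> space M" for K a z
    unfolding S_def using that by (intro order_trans[OF sum_abs] sum_bounded_above diffB) auto
  have fi: "(\<lambda>z. f a (z i)) \<in> borel_measurable (PiM K (\<lambda>_. M))" if "a \<in> D" "i \<in> K" for a K and i :: 'i
    using measurable_compose[OF measurable_component_singleton[OF that(2)] f[OF that(1)]] .
  have Sm: "(\<lambda>z. S K a z) \<in> borel_measurable (PiM K' (\<lambda>_. M))" if "a \<in> D" "K \<subseteq> K'" for a K K'
    unfolding S_def using that
    by (intro borel_measurable_sum borel_measurable_diff measurable_compose[OF fi \<phi>m]) auto
  let ?n = "real (card J) * (2 * B')"
  \<comment> \<open>Three stages of the induction step: in \<open>L\<close> all coordinates are
    still centered, in \<open>G\<close> the coordinate \<open>k\<close> alone carries a sign,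
    averaged over both values, and in \<open>R\<close> all coordinates carry signs.\<close>
  define L where "L z = (SUP a\<in>D. h a + S (insert k J) a z)" for z
  define G where "G z = ((SUP a\<in>D. h a + S J a z + 2 * f a (z k)) + (SUP a\<in>D. h a + S J a z - 2 * f a (z k))) / 2" for z
  define R where "R K h z = (\<Sum>\<sigma>\<in>K \<rightarrow>\<^sub>E {-1, 1}. SUP a\<in>D. h a + 2 * (\<Sum>i\<in>K. \<sigma> i * f a (z i))) / 2 ^ card K"
    for K :: "'i set" and h z
  have termL: "\<bar>h a + S (insert k J) a z\<bar> \<le> C + real (card (insert k J)) * (2 * B')"
    if "a \<in> D" "z \<in> space ?PI" for a z
    using h[OF that(1)] SB[OF that(1), of "insert k J" z, OF comp[OF that(2)]] by linarith
  have Lm: "L \<in> borel_measurable ?PI"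
    unfolding L_def by (rule cSUP_measurable_bounded[OF D(1) _ termL])
      (intro borel_measurable_add borel_measurable_const Sm subset_refl)
  have Lb: "\<bar>L z\<bar> \<le> C + real (card (insert k J)) * (2 * B')" if "z \<in> space ?PI" for z
    unfolding L_def by (rule abs_cSUP_le[OF D(2) termL[OF _ that]])
  have hJ: "\<bar>h a + S J a z\<bar> \<le> C + ?n" if "a \<in> D" "z \<in> space ?PJ" for a z
    using h[OF that(1)] SB[OF that(1), of J z, OF comp[OF that(2)]] by linarith
  have termG: "\<bar>h a + S J a z + 2 * f a (z k)\<bar> \<le> C + ?n + 2 * B"
    "\<bar>h a + S J a z - 2 * f a (z k)\<bar> \<le> C + ?n + 2 * B"
    if "a \<in> D" "z \<in> space ?PI" for a z
    using h[OF that(1)] SB[OF that(1), of J z, OF comp[OF that(2) insertI2]] B[OF that(1), of "z k", OF comp[OF that(2) insertI1]]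
    by linarith+
  have Gm: "G \<in> borel_measurable ?PI"
    unfolding G_def
    by (intro borel_measurable_divide borel_measurable_add borel_measurable_diff borel_measurable_times
          borel_measurable_const fi Sm cSUP_measurable_bounded[OF D(1) _ termG(1)]
          cSUP_measurable_bounded[OF D(1) _ termG(2)] insertI1 subset_insertI)
  have Gb: "\<bar>G z\<bar> \<le> C + ?n + 2 * B" if "z \<in> space ?PI" for z
  proof -
    have mean: "\<bar>(p + q) / 2\<bar> \<le> b" if "\<bar>p\<bar> \<le> b" "\<bar>q\<bar> \<le> b" for p q b :: real
      using that by (simp add: abs_le_iff)
    show ?thesis
      unfolding G_def by (intro mean abs_cSUP_le[OF D(2)] termG that)
  qed
  have sgn: "\<bar>\<sigma> i * y\<bar> = \<bar>y\<bar>" if "\<sigma> \<in> K \<rightarrow>\<^sub>E {-1, 1::real}" "i \<in> K" for \<sigma> and K :: "'i set" and i and y :: real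
    using PiE_mem[OF that] by auto
  have sumb: "\<bar>\<Sum>i\<in>K. \<sigma> i * f a (z i)\<bar> \<le> real (card K) * B"
    if "a \<in> D" "\<And>i. i \<in> K \<Longrightarrow> z i \<in> space M" "\<sigma> \<in> K \<rightarrow>\<^sub>E {-1, 1}" for a z \<sigma> and K :: "'i set"
  proof (intro order_trans[OF sum_abs] sum_bounded_above)
    show "\<bar>\<sigma> i * f a (z i)\<bar> \<le> B" if "i \<in> K" for i
      unfolding sgn[OF \<open>\<sigma> \<in> K \<rightarrow>\<^sub>E {-1, 1}\<close> that] using B[OF \<open>a \<in> D\<close>] \<open>\<And>i. i \<in> K \<Longrightarrow> z i \<in> space M\<close>[OF that] .
  qed
  have termR: "\<bar>h a + 2 * (\<Sum>i\<in>K. \<sigma> i * f a (z i))\<bar> \<le> C' + 2 * (real (card K) * B)"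
    if "a \<in> D" "\<And>a. a \<in> D \<Longrightarrow> \<bar>h a\<bar> \<le> C'" "z \<in> space (PiM K (\<lambda>_. M))" "\<sigma> \<in> K \<rightarrow>\<^sub>E {-1, 1}"
    for h C' a z \<sigma> and K :: "'i set"
    using sumb[OF that(1) _ that(4), of z, OF comp[OF that(3)]] that(2)[OF that(1)] by linarith
  have Rm: "R K h \<in> borel_measurable (PiM K (\<lambda>_. M))"
    if "\<And>a. a \<in> D \<Longrightarrow> \<bar>h a\<bar> \<le> C'" for h C' and K :: "'i set"
    unfolding R_def
    by (intro borel_measurable_divide borel_measurable_sum borel_measurable_add borel_measurable_times
       borel_measurable_const fi cSUP_measurable_bounded[OF D(1) _ termR[OF _ that]])
  have Rb: "\<bar>R K h z\<bar> \<le> C' + 2 * (real (card K) * B)"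
    if "\<And>a. a \<in> D \<Longrightarrow> \<bar>h a\<bar> \<le> C'" "z \<in> space (PiM K (\<lambda>_. M))" "finite K" for h C' z and K :: "'i set"
  proof -
    have "\<bar>\<Sum>\<sigma>\<in>K \<rightarrow>\<^sub>E {-1, 1}. SUP a\<in>D. h a + 2 * (\<Sum>i\<in>K. \<sigma> i * f a (z i))\<bar>
        \<le> real (card (K \<rightarrow>\<^sub>E {-1, 1::real})) * (C' + 2 * (real (card K) * B))"
      by (intro order_trans[OF sum_abs] sum_bounded_above abs_cSUP_le[OF D(2)] termR that)
    also have "real (card (K \<rightarrow>\<^sub>E {-1, 1::real})) = 2 ^ card K"
      by (simp add: card_funcsetE[OF that(3)])
    finally show ?thesis unfolding R_def by (simp add: field_simps)
  qed
  have Lupd: "L (z(k := x)) = (SUP a\<in>D. (h a + S J a z) + (\<phi> (f a x) - e a))" for z x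
  proof -
    have "S J a (z(k := x)) = S J a z" for a
      unfolding S_def by (rule sum.cong) (use insert.hyps in auto)
    then have "S (insert k J) a (z(k := x)) = S J a z + (\<phi> (f a x) - e a)" for a
      unfolding S_def by (subst sum.insert) (use insert.hyps in auto)
    then show ?thesis by (simp add: L_def add.assoc)
  qed
  have Gupd: "G (z(k := x)) = ((SUP a\<in>D. (h a + S J a z) + 2 * f a x) + (SUP a\<in>D. (h a + S J a z) - 2 * f a x)) / 2" for z x
  proof -
    have "S J a (z(k := x)) = S J a z" for a
      unfolding S_def by (rule sum.cong) (use insert.hyps in auto)
    then show ?thesis by (simp add: G_def)
  qed
  \<comment> \<open>Splitting the sign vectors by the sign at \<open>k\<close> turns the symmetrized
    average over \<open>insert k J\<close> into two averages over \<open>J\<close>, whose offsets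
    have absorbed the term of coordinate \<open>k\<close>.\<close>
  have Rupd: "R (insert k J) h (z(k := x)) = (R J (\<lambda>a. h a + 2 * f a x) z + R J (\<lambda>a. h a - 2 * f a x) z) / 2" for z x
  proof -
    have *: "(\<Sum>i\<in>insert k J. (\<sigma>(k := y)) i * f a ((z(k := x)) i)) = y * f a x + (\<Sum>i\<in>J. \<sigma> i * f a (z i))"
      for \<sigma> a y
    proof -
      have "(\<Sum>i\<in>J. (\<sigma>(k := y)) i * f a ((z(k := x)) i)) = (\<Sum>i\<in>J. \<sigma> i * f a (z i))"
        by (rule sum.cong) (use insert.hyps in auto)
      then show ?thesis by (subst sum.insert) (use insert.hyps in auto)
    qed
    have eq: "h a + 2 * (1 * f a x + s) = h a + 2 * f a x + 2 * s"
      "h a + 2 * (- 1 * f a x + s) = h a - 2 * f a x + 2 * s" for a s by simp_all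
    show ?thesis
      unfolding R_def sum_signs_insert[OF insert.hyps] * eq
      using insert.hyps by (simp only: sum.distrib card_insert_disjoint power_Suc) (simp add: add_divide_distrib)
  qed
  have "(\<integral>z. L z \<partial>?PI) = (\<integral>z. \<integral>x. L (z(k := x)) \<partial>M \<partial>?PJ)"
    by (rule integral_PiM_insert[OF M insert.hyps Lm Lb])
  also have "\<dots> \<le> (\<integral>z. \<integral>x. G (z(k := x)) \<partial>M \<partial>?PJ)"
  proof (rule integral_mono)
    interpret J: product_prob_space "\<lambda>_. M" J by unfold_locales
    note [measurable] = Lm Gm
    show "integrable ?PJ (\<lambda>z. \<integral>x. L (z(k := x)) \<partial>M)"
    proof (rule integrable_bounded[OF PM])
      show "\<bar>\<integral>x. L (z(k := x)) \<partial>M\<bar> \<le> C + real (card (insert k J)) * (2 * B')" if "z \<in> space ?PJ" for z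
        by (rule abs_integral_le_bound[OF M measurable_compose[OF measurable_component_update[OF that insert.hyps(2)] Lm]])
          (rule Lb[OF fun_upd_in_space_PiM[OF that]])
    qed measurable
    show "integrable ?PJ (\<lambda>z. \<integral>x. G (z(k := x)) \<partial>M)"
    proof (rule integrable_bounded[OF PM])
      show "\<bar>\<integral>x. G (z(k := x)) \<partial>M\<bar> \<le> C + ?n + 2 * B" if "z \<in> space ?PJ" for z
        by (rule abs_integral_le_bound[OF M measurable_compose[OF measurable_component_update[OF that insert.hyps(2)] Gm]])
          (rule Gb[OF fun_upd_in_space_PiM[OF that]])
    qed measurable
    show "(\<integral>x. L (z(k := x)) \<partial>M) \<le> (\<integral>x. G (z(k := x)) \<partial>M)" if z: "z \<in> space ?PJ" for z
      unfolding Lupd Gupd e_def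
      by (rule symmetrization_step[OF M D f B \<phi> hJ]) (use z in auto)
  qed
  also have "\<dots> = (\<integral>z. G z \<partial>?PI)"
    by (rule integral_PiM_insert(1)[OF M insert.hyps Gm Gb, symmetric])
  \<comment> \<open>The order of integration is exchanged so that \<open>x\<close> is frozen. The
    terms \<open>2 * f a x\<close> and \<open>- 2 * f a x\<close> are then bounded functions of
    \<open>a\<close> alone and can join the offset when the induction hypothesis is used; this is
    why \<open>h\<close> and its bound \<open>C\<close> vary in the induction.\<close>
  also have "\<dots> = (\<integral>x. \<integral>z. G (z(k := x)) \<partial>?PJ \<partial>M)"
    by (rule integral_PiM_insert(2)[OF M insert.hyps Gm Gb])
  also have "\<dots> \<le> (\<integral>x. \<integral>z. R (insert k J) h (z(k := x)) \<partial>?PJ \<partial>M)"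
  proof (rule integral_mono)
    interpret J: product_prob_space "\<lambda>_. M" J by unfold_locales
    have Rm' [measurable]: "R (insert k J) h \<in> borel_measurable ?PI" by (rule Rm[OF h])
    note [measurable] = Gm
    have Rb': "\<bar>R (insert k J) h z\<bar> \<le> C + 2 * (real (card (insert k J)) * B)" if "z \<in> space ?PI" for z
      using insert.hyps by (intro Rb h that) auto
    have upd: "(\<lambda>z. z(k := x)) \<in> measurable ?PJ ?PI" if "x \<in> space M" for x
      by (rule measurable_fun_upd) (use that in auto)
    show "integrable M (\<lambda>x. \<integral>z. G (z(k := x)) \<partial>?PJ)"
    proof (rule integrable_bounded[OF M])
      show "\<bar>\<integral>z. G (z(k := x)) \<partial>?PJ\<bar> \<le> C + ?n + 2 * B" if "x \<in> space M" for x
        by (rule abs_integral_le_bound[OF PM measurable_compose[OF upd[OF that] Gm]])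
          (rule Gb[OF fun_upd_in_space_PiM[OF _ that]])
    qed measurable
    show "integrable M (\<lambda>x. \<integral>z. R (insert k J) h (z(k := x)) \<partial>?PJ)"
    proof (rule integrable_bounded[OF M])
      show "\<bar>\<integral>z. R (insert k J) h (z(k := x)) \<partial>?PJ\<bar> \<le> C + 2 * (real (card (insert k J)) * B)" if "x \<in> space M" for x
        by (rule abs_integral_le_bound[OF PM measurable_compose[OF upd[OF that] Rm']])
          (rule Rb'[OF fun_upd_in_space_PiM[OF _ that]])
    qed measurable
    fix x assume x: "x \<in> space M"
    have hp: "\<bar>h a + 2 * f a x\<bar> \<le> C + 2 * B" and hm: "\<bar>h a - 2 * f a x\<bar> \<le> C + 2 * B" if "a \<in> D" for a
      using h[OF that] B[OF that x] by linarith+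
    have intS: "integrable ?PJ (\<lambda>z. SUP a\<in>D. h' a + S J a z)" if "\<And>a. a \<in> D \<Longrightarrow> \<bar>h' a\<bar> \<le> C'" for h' C'
    proof -
      have "\<bar>h' a + S J a z\<bar> \<le> C' + ?n" if "a \<in> D" "z \<in> space ?PJ" for a z
        using \<open>\<And>a. a \<in> D \<Longrightarrow> \<bar>h' a\<bar> \<le> C'\<close>[OF that(1)] SB[OF that(1), of J z, OF comp[OF that(2)]] by linarith
      then show ?thesis
        by (intro integrable_bounded[OF PM] cSUP_measurable_bounded[OF D(1)] abs_cSUP_le[OF D(2)]
            borel_measurable_add Sm) auto
    qed
    have intR: "integrable ?PJ (R J h')" if "\<And>a. a \<in> D \<Longrightarrow> \<bar>h' a\<bar> \<le> C'" for h' C'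
      using that insert.hyps by (intro integrable_bounded[OF PM Rm Rb]) auto
    have "(\<integral>z. G (z(k := x)) \<partial>?PJ)
      = ((\<integral>z. (SUP a\<in>D. (h a + 2 * f a x) + S J a z) \<partial>?PJ) + (\<integral>z. (SUP a\<in>D. (h a - 2 * f a x) + S J a z) \<partial>?PJ)) / 2"
      unfolding Gupd using intS[OF hp] intS[OF hm]
      by (simp add: algebra_simps)
    also have "\<dots> \<le> ((\<integral>z. R J (\<lambda>a. h a + 2 * f a x) z \<partial>?PJ) + (\<integral>z. R J (\<lambda>a. h a - 2 * f a x) z \<partial>?PJ)) / 2"
      unfolding S_def R_def e_def
      by (intro divide_right_mono add_mono insert.IH[OF hp] insert.IH[OF hm]) auto
    also have "\<dots> = (\<integral>z. R (insert k J) h (z(k := x)) \<partial>?PJ)"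
      unfolding Rupd using intR[OF hp] intR[OF hm] by simp
    finally show "(\<integral>z. G (z(k := x)) \<partial>?PJ) \<le> (\<integral>z. R (insert k J) h (z(k := x)) \<partial>?PJ)" .
  qed
  also have "\<dots> = (\<integral>z. R (insert k J) h z \<partial>?PI)"
    using insert.hyps by (intro integral_PiM_insert(2)[symmetric, OF M insert.hyps Rm[OF h] Rb[OF h]]) auto
  finally show ?case unfolding L_def R_def S_def e_def .
qed

text \<open>Prepares the symmetrization for use: any majorant \<open>Q\<close> of the signed sums,
  such as one given by a dual norm, replaces the suprema, and the offset is set to zero.\<close>

lemma integral_symmetrization_le:
  fixes f :: "'c \<Rightarrow> 'a \<Rightarrow> real" and \<phi> :: "real \<Rightarrow> real" and Q :: "('i \<Rightarrow> real) \<Rightarrow> ('i \<Rightarrow> 'a) \<Rightarrow> real"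
  assumes M: "prob_space M" and I: "finite I" and D: "countable D" "D \<noteq> {}"
    and f: "\<And>a. a \<in> D \<Longrightarrow> f a \<in> borel_measurable M"
    and B: "\<And>a x. a \<in> D \<Longrightarrow> x \<in> space M \<Longrightarrow> \<bar>f a x\<bar> \<le> B"
    and \<phi>: "1-lipschitz_on UNIV \<phi>"
    and Q: "\<And>\<sigma> z a. a \<in> D \<Longrightarrow> 2 * (\<Sum>i\<in>I. \<sigma> i * f a (z i)) \<le> Q \<sigma> z"
    and Q_nonneg: "\<And>\<sigma> z. 0 \<le> Q \<sigma> z"
    and Q_int: "\<And>\<sigma>. \<sigma> \<in> I \<rightarrow>\<^sub>E {-1, 1} \<Longrightarrow> integrable (PiM I (\<lambda>_. M)) (Q \<sigma>)"
  shows "(\<integral>z. (SUP a\<in>D. (\<Sum>i\<in>I. \<phi> (f a (z i)) - (\<integral>x. \<phi> (f a x) \<partial>M))) \<partial>PiM I (\<lambda>_. M))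
    \<le> (\<integral>z. (\<Sum>\<sigma>\<in>I \<rightarrow>\<^sub>E {-1, 1}. Q \<sigma> z) / 2 ^ card I \<partial>PiM I (\<lambda>_. M))"
proof -
  have "(\<integral>z. (SUP a\<in>D. (\<Sum>i\<in>I. \<phi> (f a (z i)) - (\<integral>x. \<phi> (f a x) \<partial>M))) \<partial>PiM I (\<lambda>_. M))
    \<le> (\<integral>z. (\<Sum>\<sigma>\<in>I \<rightarrow>\<^sub>E {-1, 1}. SUP a\<in>D. 2 * (\<Sum>i\<in>I. \<sigma> i * f a (z i))) / 2 ^ card I
        \<partial>PiM I (\<lambda>_. M))"
    using symmetrization_contraction[OF M I D f B \<phi>, where h = "\<lambda>_. 0" and C = 0] by simp
  also have "\<dots> \<le> (\<integral>z. (\<Sum>\<sigma>\<in>I \<rightarrow>\<^sub>E {-1, 1}. Q \<sigma> z) / 2 ^ card I \<partial>PiM I (\<lambda>_. M))"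
  \<comment> \<open>Integrability is shown for the majorant only. A non-integrable left side would
    have integral 0 by convention, which the nonnegativity of \<open>Q\<close> covers.\<close>
  proof (rule integral_mono')
    show "integrable (PiM I (\<lambda>_. M)) (\<lambda>z. (\<Sum>\<sigma>\<in>I \<rightarrow>\<^sub>E {-1, 1}. Q \<sigma> z) / 2 ^ card I)"
      by (intro integrable_divide Bochner_Integration.integrable_sum Q_int)
    show "(\<Sum>\<sigma>\<in>I \<rightarrow>\<^sub>E {-1, 1}. SUP a\<in>D. 2 * (\<Sum>i\<in>I. \<sigma> i * f a (z i))) / 2 ^ card I
        \<le> (\<Sum>\<sigma>\<in>I \<rightarrow>\<^sub>E {-1, 1}. Q \<sigma> z) / 2 ^ card I" for z
      by (intro divide_right_mono sum_mono cSUP_least[OF D(2)] Q) auto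
    show "0 \<le> (\<Sum>\<sigma>\<in>I \<rightarrow>\<^sub>E {-1, 1}. Q \<sigma> z) / 2 ^ card I" for z
      by (intro divide_nonneg_nonneg sum_nonneg Q_nonneg) auto
  qed
  finally show ?thesis .
qed

section \<open>Uniform deviations over a class of similarity matrices\<close>

lemma pos_part_lipschitz: "\<bar>pos_part s - pos_part t\<bar> \<le> \<bar>s - t\<bar>"
  by (auto simp: pos_part_def max_def)

lemma pos_part_bounds: "0 \<le> pos_part t" "pos_part t \<le> \<bar>t\<bar>"
  by (auto simp: pos_part_def)

lemma pos_part_measurable [measurable]: "pos_part \<in> borel_measurable borel"
  unfolding pos_part_def[abs_def] by measurable

lemma tendsto_pos_part: "(f \<longlongrightarrow> l) F \<Longrightarrow> ((\<lambda>x. pos_part (f x)) \<longlongrightarrow> pos_part l) F"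
  unfolding pos_part_def by (intro tendsto_max) auto

lemma trace_eq_inner: "trace (transpose B ** A) = B \<bullet> (A :: real^'d^'d)"
proof -
  have "trace (transpose B ** A) = (\<Sum>j\<in>UNIV. \<Sum>i\<in>UNIV. B $ i $ j * A $ i $ j)"
    by (simp add: trace_def matrix_matrix_mult_def transpose_def)
  also have "\<dots> = B \<bullet> A"
    by (subst sum.swap) (simp add: inner_vec_def)
  finally show ?thesis .
qed

lemma kerA_eq_inner: "kerA A x y = A \<bullet> outer x y"
  unfolding kerA_def outer_def
  by (simp add: inner_vec_def matrix_vector_mult_def sum_distrib_left algebra_simps)

text \<open>Symmetry of the matrices enters here. The Rademacher average is always measured in the
  first slot of the outer product, whereas the inner sample average of the empirical error stands in
  the second.\<close>

lemma inner_outer_commute: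
  fixes A :: "real^'d^'d"
  assumes "transpose A = A"
  shows "A \<bullet> outer x y = A \<bullet> outer y x"
proof -
  have "A $ i $ j = A $ j $ i" for i j
    using assms by (metis transpose_def vec_lambda_beta)
  then have "(\<Sum>i\<in>UNIV. \<Sum>j\<in>UNIV. A $ i $ j * (x $ i * y $ j)) = (\<Sum>i\<in>UNIV. \<Sum>j\<in>UNIV. A $ j $ i * (y $ j * x $ i))"
    by (intro sum.cong) (simp_all add: mult.commute)
  also have "\<dots> = (\<Sum>j\<in>UNIV. \<Sum>i\<in>UNIV. A $ j $ i * (y $ j * x $ i))"
    by (rule sum.swap)
  finally show ?thesis by (simp add: inner_vec_def outer_def)
qed

lemma bounded_bilinear_outer: "bounded_bilinear (outer :: real^'d \<Rightarrow> _)"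
proof -
  have "bilinear (outer :: real^'d \<Rightarrow> _)"
    unfolding bilinear_def
    by (auto intro!: linearI simp: outer_def vec_eq_iff algebra_simps)
  then show ?thesis by (simp add: bilinear_conv_bounded_bilinear)
qed

interpretation outer: bounded_bilinear "outer :: real^'d \<Rightarrow> _"
  by (rule bounded_bilinear_outer)

lemma borel_measurable_outer [measurable (raw)]:
  assumes "f \<in> borel_measurable M" "g \<in> borel_measurable M"
  shows "(\<lambda>x. outer (f x :: real^'d) (g x)) \<in> borel_measurable M"
  by (rule borel_measurable_continuous_Pair[OF assms])
    (intro continuous_intros outer.continuous_on)

text \<open>An abstraction free of norms and labels: \<open>u\<close> is the point multiplied by its
  label, \<open>b\<close> bounds the bilinear forms of the class on \<open>U\<close>, and
  \<open>q v\<close> majorizes them when only the first argument is fixed, so it is what the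
  Rademacher average is measured with. Closure of \<open>U\<close> under negation turns the
  one-sided bounds into absolute ones. The linear growth of \<open>q\<close> is there for
  integrability.\<close>

locale similarity_class = prob_space M
  for M :: "'a measure" +
  fixes u :: "'a \<Rightarrow> real^'d" and H :: "(real^'d^'d) set" and U :: "(real^'d) set"
    and b K r :: real and q :: "real^'d \<Rightarrow> real" and m :: nat
  assumes u_measurable [measurable]: "u \<in> borel_measurable M"
    and u_in: "x \<in> space M \<Longrightarrow> u x \<in> U"
    and bounded_U: "bounded U" and uminus_U: "v \<in> U \<Longrightarrow> - v \<in> U"
    and H_nonempty: "H \<noteq> {}" and H_sym: "A \<in> H \<Longrightarrow> transpose A = A"
    and le_b: "A \<in> H \<Longrightarrow> v \<in> U \<Longrightarrow> v' \<in> U \<Longrightarrow> A \<bullet> outer v v' \<le> b"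
    and le_q: "A \<in> H \<Longrightarrow> v' \<in> U \<Longrightarrow> A \<bullet> outer v v' \<le> q v"
    and q_measurable [measurable]: "q \<in> borel_measurable borel"
    and q_nonneg: "0 \<le> q v" and q_le: "q v \<le> K * norm v"
    and r_pos: "r > 0" and m_pos: "m > 0" and b_pos: "b > 0" and K_nonneg: "K \<ge> 0"
begin

text \<open>As the outer product is linear in its second argument, the inner integral of the
  population error depends on the distribution only through this vector.\<close>

definition w :: "real^'d" where "w = (\<integral>x. u x \<partial>M)"

definition emp :: "(nat \<Rightarrow> 'a) \<Rightarrow> real^'d^'d \<Rightarrow> real" where
  "emp z A = (1 / real m) * (\<Sum>i<m. pos_part (1 - (1 / (real m * r)) *
      (\<Sum>j<m. A \<bullet> outer (u (z i)) (u (z j)))))"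

definition pop :: "real^'d^'d \<Rightarrow> real" where
  "pop A = (\<integral>x. pos_part (1 - (1 / r) * (A \<bullet> outer (u x) w)) \<partial>M)"

definition rad :: real where
  "rad = (\<integral>z. (\<Sum>\<sigma>\<in>{..<m} \<rightarrow>\<^sub>E {-1, 1}. q ((1 / real m) *\<^sub>R (\<Sum>i<m. \<sigma> i *\<^sub>R u (z i)))) / 2 ^ m
    \<partial>PiM {..<m} (\<lambda>_. M))"

lemma U_nonempty: "U \<noteq> {}"
  using not_empty u_in by auto

lemma abs_le_b: "A \<in> H \<Longrightarrow> v \<in> U \<Longrightarrow> v' \<in> U \<Longrightarrow> \<bar>A \<bullet> outer v v'\<bar> \<le> b"
  using le_b[of A v v'] le_b[of A "- v" v'] uminus_U[of v] by (simp add: outer.minus_left abs_le_iff)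

lemma integrable_u: "integrable M u"
proof -
  obtain R where "\<And>v. v \<in> U \<Longrightarrow> norm v \<le> R" using bounded_U by (auto simp: bounded_iff)
  then show ?thesis by (intro integrable_const_bound[of _ R]) (auto simp: u_in)
qed

lemma inner_outer_w: "A \<bullet> outer v w = (\<integral>x. A \<bullet> outer v (u x) \<partial>M)"
proof -
  have "bounded_linear (\<lambda>x. A \<bullet> outer v x)"
    by (intro bounded_linear_compose[OF bounded_linear_inner_right outer.bounded_linear_right])
  from integral_bounded_linear[OF this integrable_u] show ?thesis by (simp add: w_def)
qed

text \<open>The mean \<open>w\<close> may lie outside \<open>U\<close>, which is not assumed convex,
  but bounds valid for every \<open>u x\<close> survive averaging. The same argument gives the
  majorant \<open>q\<close> in the next lemma.\<close>

lemma abs_outer_w_le: 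
  assumes "A \<in> H" "v \<in> U" shows "\<bar>A \<bullet> outer v w\<bar> \<le> b"
  unfolding inner_outer_w
  by (rule abs_integral_le_bound[OF prob_space_axioms]) (use assms u_in in \<open>auto intro: abs_le_b\<close>)

lemma outer_w_le_q: 
  assumes "A \<in> H" shows "A \<bullet> outer v w \<le> q v"
proof -
  have "bounded_linear (\<lambda>x. A \<bullet> outer v x)"
    by (intro bounded_linear_compose[OF bounded_linear_inner_right outer.bounded_linear_right])
  from integrable_bounded_linear[OF this integrable_u] show ?thesis
    unfolding inner_outer_w by (intro integral_le_const) (auto intro: le_q[OF assms u_in])
qed

lemma prob_space_sample: "prob_space (PiM {..<m} (\<lambda>_. M))"
  by (intro prob_space_PiM prob_space_axioms)

lemma component_in: "z \<in> space (PiM {..<m} (\<lambda>_. M)) \<Longrightarrow> i < m \<Longrightarrow> z i \<in> space M"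
  by (auto simp: space_PiM)

lemma u_component_measurable [measurable]:
  "i < m \<Longrightarrow> (\<lambda>z. u (z i)) \<in> borel_measurable (PiM {..<m} (\<lambda>_. M))"
  by measurable

lemma emp_measurable: "(\<lambda>z. emp z A) \<in> borel_measurable (PiM {..<m} (\<lambda>_. M))"
  unfolding emp_def by measurable

lemma abs_pos_part_le:
  assumes "\<bar>t\<bar> \<le> b / r" shows "\<bar>pos_part (1 - t)\<bar> \<le> 1 + b / r"
proof -
  have "\<bar>pos_part (1 - t)\<bar> \<le> \<bar>1 - t\<bar>"
    using pos_part_bounds[of "1 - t"] by simp
  also have "\<dots> \<le> 1 + \<bar>t\<bar>" by simp
  finally show ?thesis using assms by simp
qed

lemma abs_emp_le:
  assumes A: "A \<in> H" and z: "z \<in> space (PiM {..<m} (\<lambda>_. M))"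
  shows "\<bar>emp z A\<bar> \<le> 1 + b / r"
proof -
  have "\<bar>pos_part (1 - (1 / (real m * r)) * (\<Sum>j<m. A \<bullet> outer (u (z i)) (u (z j))))\<bar> \<le> 1 + b / r"
    if "i < m" for i
  proof (rule abs_pos_part_le)
    have "\<bar>\<Sum>j<m. A \<bullet> outer (u (z i)) (u (z j))\<bar> \<le> real (card {..<m}) * b"
      by (intro order_trans[OF sum_abs] sum_bounded_above abs_le_b[OF A] u_in component_in[OF z])
        (use that in auto)
    then show "\<bar>(1 / (real m * r)) * (\<Sum>j<m. A \<bullet> outer (u (z i)) (u (z j)))\<bar> \<le> b / r"
      using m_pos r_pos by (simp add: abs_mult field_simps)
  qed
  then have "\<bar>\<Sum>i<m. pos_part (1 - (1 / (real m * r)) * (\<Sum>j<m. A \<bullet> outer (u (z i)) (u (z j))))\<bar>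
      \<le> real (card {..<m}) * (1 + b / r)"
    by (intro order_trans[OF sum_abs] sum_bounded_above) auto
  then show ?thesis unfolding emp_def using m_pos by (simp add: abs_mult field_simps)
qed

lemma abs_pop_term_le:
  assumes A: "A \<in> H" and x: "x \<in> space M"
  shows "\<bar>pos_part (1 - (1 / r) * (A \<bullet> outer (u x) w))\<bar> \<le> 1 + b / r"
  by (rule abs_pos_part_le)
    (use abs_outer_w_le[OF A u_in[OF x]] r_pos in \<open>simp add: abs_mult divide_right_mono\<close>)

lemma abs_pop_le: "A \<in> H \<Longrightarrow> \<bar>pop A\<bar> \<le> 1 + b / r"
  unfolding pop_def by (rule abs_integral_le_bound[OF prob_space_axioms]) (measurable, rule abs_pop_term_le)

lemma abs_gap_le:
  assumes "A \<in> H" "z \<in> space (PiM {..<m} (\<lambda>_. M))"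
  shows "\<bar>emp z A - pop A\<bar> \<le> 2 * (1 + b / r)"
  using order_trans[OF abs_triangle_ineq4 add_mono[OF abs_emp_le[OF assms] abs_pop_le[OF assms(1)]]]
  by simp

text \<open>Both errors are continuous in the matrix along sequences from \<open>D\<close>, the
  population error by dominated convergence with the uniform bound on the hinge. A bound on a
  countable dense subset therefore reaches every member of the class.\<close>

lemma gap_le_of_dense:
  assumes D: "D \<subseteq> H" and A: "A \<in> H" "A \<in> closure D"
    and z: "z \<in> space (PiM {..<m} (\<lambda>_. M))"
    and c: "\<And>A'. A' \<in> D \<Longrightarrow> emp z A' - pop A' \<le> c"
  shows "emp z A - pop A \<le> c"
proof -
  obtain a where a: "\<And>n. a n \<in> D" "a \<longlonglongrightarrow> A"
    using A(2) by (auto simp: closure_sequential)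
  have e: "(\<lambda>n. emp z (a n)) \<longlonglongrightarrow> emp z A"
    unfolding emp_def by (intro tendsto_intros tendsto_pos_part a)
  have p: "(\<lambda>n. pop (a n)) \<longlonglongrightarrow> pop A"
    unfolding pop_def
  proof (rule integral_dominated_convergence[where w = "\<lambda>_. 1 + b / r"])
    show "AE x in M. (\<lambda>n. pos_part (1 - (1 / r) * (a n \<bullet> outer (u x) w)))
        \<longlonglongrightarrow> pos_part (1 - (1 / r) * (A \<bullet> outer (u x) w))"
      by (intro AE_I2 tendsto_intros tendsto_pos_part a)
    show "AE x in M. norm (pos_part (1 - (1 / r) * (a n \<bullet> outer (u x) w))) \<le> 1 + b / r" for n
      unfolding real_norm_def using a(1) D by (intro AE_I2 abs_pop_term_le) auto
  qed auto
  show ?thesis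
    by (rule LIMSEQ_le_const2[OF tendsto_diff[OF e p]]) (use c a in auto)
qed

text \<open>A new point \<open>k\<close> alters only row \<open>k\<close> and column
  \<open>k\<close> of the matrix of pairings. These are \<open>2 * m\<close> entries when the
  diagonal one is counted twice, each changes by at most \<open>2 * b\<close>, and each has weight
  \<open>1 / (m\<^sup>2 * r)\<close>.\<close>

lemma emp_bounded_difference:
  assumes A: "A \<in> H" and z: "z \<in> space (PiM {..<m} (\<lambda>_. M))" and k: "k < m" and x: "x \<in> space M"
  shows "emp (z(k := x)) A - emp z A \<le> 4 * b / (real m * r)"
proof -
  define z' where "z' = z(k := x)"
  have z': "z' \<in> space (PiM {..<m} (\<lambda>_. M))"
    unfolding z'_def using fun_upd_in_space_PiM[OF z x, of k] k by (simp add: insert_absorb)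
  define g where "g z i j = A \<bullet> outer (u (z i)) (u (z j))" for z :: "nat \<Rightarrow> 'a" and i j
  have g: "\<bar>g z i j\<bar> \<le> b" if "z \<in> space (PiM {..<m} (\<lambda>_. M))" "i < m" "j < m" for z :: "nat \<Rightarrow> 'a" and i j
    unfolding g_def using that by (intro abs_le_b A u_in component_in) auto
  \<comment> \<open>Adding the two indicators counts the entry with \<open>i = j = k\<close> twice.
    This only weakens the bound and makes the total count exactly \<open>2 * m\<close>.\<close>
  have d: "\<bar>g z' i j - g z i j\<bar> \<le> 2 * b * (of_bool (i = k) + of_bool (j = k))" if "i < m" "j < m" for i j
  proof (cases "i = k \<or> j = k")
    case True
    have "\<bar>g z' i j - g z i j\<bar> \<le> 2 * b"
      using g[OF z that] g[OF z' that] by linarith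
    also have "\<dots> \<le> 2 * b * (of_bool (i = k) + of_bool (j = k))"
      using True b_pos by auto
    finally show ?thesis .
  next
    case False
    then show ?thesis by (simp add: g_def z'_def)
  qed
  have "emp z' A - emp z A = (1 / real m) * (\<Sum>i<m. pos_part (1 - (1 / (real m * r)) * (\<Sum>j<m. g z' i j))
      - pos_part (1 - (1 / (real m * r)) * (\<Sum>j<m. g z i j)))"
    by (simp add: emp_def g_def sum_subtractf right_diff_distrib)
  also have "\<dots> \<le> (1 / real m) * (\<Sum>i<m. (1 / (real m * r)) * (\<Sum>j<m. 2 * b * (of_bool (i = k) + of_bool (j = k))))"
  proof (intro mult_left_mono sum_mono)
    fix i assume i: "i \<in> {..<m}"
    have "pos_part (1 - (1 / (real m * r)) * (\<Sum>j<m. g z' i j)) - pos_part (1 - (1 / (real m * r)) * (\<Sum>j<m. g z i j))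
        \<le> \<bar>(1 - (1 / (real m * r)) * (\<Sum>j<m. g z' i j)) - (1 - (1 / (real m * r)) * (\<Sum>j<m. g z i j))\<bar>"
      using pos_part_lipschitz abs_le_D1 by blast
    also have "\<dots> = \<bar>(1 / (real m * r)) * (\<Sum>j<m. g z' i j - g z i j)\<bar>"
      by (simp add: sum_subtractf right_diff_distrib abs_minus_commute)
    also have "\<dots> = (1 / (real m * r)) * \<bar>\<Sum>j<m. g z' i j - g z i j\<bar>"
      using r_pos by (simp add: abs_mult)
    also have "\<dots> \<le> (1 / (real m * r)) * (\<Sum>j<m. 2 * b * (of_bool (i = k) + of_bool (j = k)))"
      using i r_pos by (intro mult_left_mono order_trans[OF sum_abs] sum_mono d) auto
    finally show "pos_part (1 - (1 / (real m * r)) * (\<Sum>j<m. g z' i j)) - pos_part (1 - (1 / (real m * r)) * (\<Sum>j<m. g z i j))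
        \<le> (1 / (real m * r)) * (\<Sum>j<m. 2 * b * (of_bool (i = k) + of_bool (j = k)))" .
  qed simp
  also have "\<dots> = (1 / real m) * ((1 / (real m * r)) * (2 * b * (\<Sum>i<m. \<Sum>j<m. of_bool (i = k) + of_bool (j = k))))"
    by (simp only: sum_distrib_left)
  also have "(\<Sum>i<m. \<Sum>j<m. of_bool (i = k) + of_bool (j = k)) = 2 * real m"
    using k by (simp add: sum.distrib of_bool_def sum_distrib_left[symmetric])
  also have "(1 / real m) * ((1 / (real m * r)) * (2 * b * (2 * real m))) = 4 * b / (real m * r)"
    using m_pos r_pos by (simp add: field_simps)
  finally show ?thesis unfolding z'_def .
qed

abbreviation rad_arg :: "(nat \<Rightarrow> real) \<Rightarrow> (nat \<Rightarrow> 'a) \<Rightarrow> real^'d" where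
  "rad_arg \<sigma> z \<equiv> (1 / real m) *\<^sub>R (\<Sum>i<m. \<sigma> i *\<^sub>R u (z i))"

lemma rad_arg_measurable: "rad_arg \<sigma> \<in> borel_measurable (PiM {..<m} (\<lambda>_. M))"
  by measurable

lemma integrable_q_rad_arg: "integrable (PiM {..<m} (\<lambda>_. M)) (\<lambda>z. q (rad_arg \<sigma> z))"
proof -
  obtain R where R: "\<And>v. v \<in> U \<Longrightarrow> norm v \<le> R" using bounded_U by (auto simp: bounded_iff)
  show ?thesis
  proof (rule integrable_bounded[OF prob_space_sample])
    show "(\<lambda>z. q (rad_arg \<sigma> z)) \<in> borel_measurable (PiM {..<m} (\<lambda>_. M))"
      using rad_arg_measurable by measurable
    fix z assume z: "z \<in> space (PiM {..<m} (\<lambda>_. M))"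
    have "norm (\<Sum>i<m. \<sigma> i *\<^sub>R u (z i)) \<le> (\<Sum>i<m. \<bar>\<sigma> i\<bar> * R)"
      using R u_in component_in[OF z] by (intro sum_norm_le) (auto intro!: mult_left_mono)
    then have "norm (rad_arg \<sigma> z) \<le> (1 / real m) * (\<Sum>i<m. \<bar>\<sigma> i\<bar> * R)"
      by (simp add: divide_right_mono)
    then have "q (rad_arg \<sigma> z) \<le> K * ((1 / real m) * (\<Sum>i<m. \<bar>\<sigma> i\<bar> * R))"
      using q_le[of "rad_arg \<sigma> z"] mult_left_mono[OF _ K_nonneg] by (meson order_trans)
    then show "\<bar>q (rad_arg \<sigma> z)\<bar> \<le> K * ((1 / real m) * (\<Sum>i<m. \<bar>\<sigma> i\<bar> * R))"
      using q_nonneg by simp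
  qed
qed

lemma inner_rad_arg_left: "A \<bullet> outer (rad_arg \<sigma> z) v = (\<Sum>i<m. \<sigma> i * ((1 / real m) * (A \<bullet> outer (u (z i)) v)))"
  by (simp add: outer.scaleR_left outer.sum_left inner_sum_right sum_distrib_left mult.left_commute)

lemma rad_scaled:
  "(\<integral>z. (\<Sum>\<sigma>\<in>{..<m} \<rightarrow>\<^sub>E {-1, 1}. c * q (rad_arg \<sigma> z)) / 2 ^ card {..<m} \<partial>PiM {..<m} (\<lambda>_. M)) = c * rad"
  unfolding rad_def by (simp add: sum_distrib_left[symmetric] flip: times_divide_eq_right)

lemma rad_nonneg: "0 \<le> rad"
  unfolding rad_def by (intro Bochner_Integration.integral_nonneg divide_nonneg_nonneg sum_nonneg q_nonneg) auto

text \<open>The two averages in the empirical error are decoupled: the inner one is compared with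
  its mean \<open>w\<close> uniformly over the class, and the outer one is an ordinary empirical process.\<close>
lemma expected_sup_gap_le:
  assumes D: "countable D" "D \<noteq> {}" "D \<subseteq> H"
  shows "(\<integral>z. (SUP A\<in>D. emp z A - pop A) \<partial>PiM {..<m} (\<lambda>_. M)) \<le> 4 / r * rad"
proof -
  let ?P = "PiM {..<m} (\<lambda>_. M)"
  \<comment> \<open>The first process is indexed by pairs, with the second component ranging over
    all of \<open>U\<close>, so that a bound on it also applies at points which come from the
    sample.\<close>
  obtain E where E: "countable E" "E \<subseteq> H \<times> U" "H \<times> U \<subseteq> closure E"
    using separable by blast
  have E_ne: "E \<noteq> {}" using E(3) H_nonempty U_nonempty by auto
  define g where "g p y = (1 / real m) * (fst p \<bullet> outer (snd p) (u y))" for p y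
  \<comment> \<open>The scaling is chosen so that \<open>\<phi> (t A y)\<close> is
    \<open>1 / m\<close> times the population hinge term while \<open>\<phi>\<close> has Lipschitz
    constant exactly 1: the outer \<open>1 / m\<close> cancels the \<open>m\<close> inside the
    hinge. The factor \<open>1 / r\<close> stays in \<open>t\<close> and produces the
    \<open>2 / r\<close> in \<open>W_le\<close>.\<close>
  define t where "t A y = (1 / (real m * r)) * (A \<bullet> outer (u y) w)" for A y
  define \<phi> where "\<phi> s = (1 / real m) * pos_part (1 - real m * s)" for s
  have id_lip: "1-lipschitz_on UNIV (\<lambda>x. x :: real)" by (rule lipschitz_on_id)
  have \<phi>_lip: "1-lipschitz_on UNIV \<phi>"
  proof (rule lipschitz_onI)
    fix s s' :: real
    have "\<bar>\<phi> s - \<phi> s'\<bar> = (1 / real m) * \<bar>pos_part (1 - real m * s) - pos_part (1 - real m * s')\<bar>"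
      unfolding \<phi>_def right_diff_distrib[symmetric] by (simp add: abs_mult)
    also have "\<dots> \<le> (1 / real m) * \<bar>(1 - real m * s) - (1 - real m * s')\<bar>"
      by (intro mult_left_mono pos_part_lipschitz) auto
    also have "\<dots> = (1 / real m) * \<bar>real m * (s' - s)\<bar>" by (simp add: algebra_simps)
    also have "\<dots> = \<bar>s - s'\<bar>" using m_pos by (simp add: abs_mult abs_minus_commute)
    finally show "dist (\<phi> s) (\<phi> s') \<le> 1 * dist s s'" by (simp add: dist_real_def)
  qed simp
  have g_m: "g p \<in> borel_measurable M" for p unfolding g_def by measurable
  have g_b: "\<bar>g p y\<bar> \<le> (1 / real m) * b" if "p \<in> E" "y \<in> space M" for p y
    using abs_le_b[of "fst p" "snd p" "u y"] E(2) that u_in unfolding g_def abs_mult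
    by (intro mult_mono) auto
  have t_m: "t A \<in> borel_measurable M" for A unfolding t_def by measurable
  have t_b: "\<bar>t A y\<bar> \<le> (1 / (real m * r)) * b" if "A \<in> D" "y \<in> space M" for A y
    using abs_outer_w_le[of A "u y"] D(3) that u_in r_pos unfolding t_def abs_mult
    by (intro mult_mono) auto
  define V where "V z = (SUP p\<in>E. \<Sum>j<m. g p (z j) - (\<integral>y. g p y \<partial>M))" for z
  define W where "W z = (SUP A\<in>D. \<Sum>i<m. \<phi> (t A (z i)) - (\<integral>y. \<phi> (t A y) \<partial>M))" for z
  have V_le: "(\<integral>z. V z \<partial>?P) \<le> 2 * rad"
    unfolding V_def rad_scaled[of 2, symmetric]
  proof (rule integral_symmetrization_le[OF prob_space_axioms _ E(1) E_ne g_m g_b id_lip])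
    show "2 * (\<Sum>i<m. \<sigma> i * g p (z i)) \<le> 2 * q (rad_arg \<sigma> z)" if "p \<in> E" for p \<sigma> z
    proof -
      have p: "fst p \<in> H" "snd p \<in> U" using E(2) that by auto
      have "(\<Sum>i<m. \<sigma> i * g p (z i)) = fst p \<bullet> outer (rad_arg \<sigma> z) (snd p)"
        \<comment> \<open>In \<open>g\<close> the random vector is the second argument; symmetry of
          the matrix moves it to the first, where \<open>q\<close> measures it.\<close>
        unfolding inner_rad_arg_left g_def inner_outer_commute[OF H_sym[OF p(1)], of "snd p"] ..
      also have "\<dots> \<le> q (rad_arg \<sigma> z)" by (rule le_q[OF p])
      finally show ?thesis by simp
    qed
  qed (auto intro: integrable_q_rad_arg q_nonneg)
  have W_le: "(\<integral>z. W z \<partial>?P) \<le> (2 / r) * rad"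
    unfolding W_def rad_scaled[of "2 / r", symmetric]
  proof (rule integral_symmetrization_le[OF prob_space_axioms _ D(1,2) t_m t_b \<phi>_lip])
    show "2 * (\<Sum>i<m. \<sigma> i * t A (z i)) \<le> (2 / r) * q (rad_arg \<sigma> z)" if "A \<in> D" for A \<sigma> z
    proof -
      have A: "A \<in> H" using D that by auto
      have "2 * (\<Sum>i<m. \<sigma> i * t A (z i)) = (2 / r) * (A \<bullet> outer (rad_arg \<sigma> z) w)"
        unfolding inner_rad_arg_left t_def sum_distrib_left by (intro sum.cong) simp_all
      also have "\<dots> \<le> (2 / r) * q (rad_arg \<sigma> z)"
        using r_pos by (intro mult_left_mono outer_w_le_q[OF A]) auto
      finally show ?thesis .
    qed
  qed (use r_pos q_nonneg in \<open>auto intro!: integrable_mult_right integrable_q_rad_arg mult_nonneg_nonneg\<close>)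
  have V_term: "\<bar>\<Sum>j<m. g p (z j) - (\<integral>y. g p y \<partial>M)\<bar> \<le> real m * (2 * ((1 / real m) * b))"
    if "p \<in> E" "z \<in> space ?P" for p z
  proof -
    have "\<bar>g p (z j) - (\<integral>y. g p y \<partial>M)\<bar> \<le> 2 * ((1 / real m) * b)" if "j < m" for j
      using order_trans[OF abs_triangle_ineq4 add_mono[OF g_b[OF \<open>p \<in> E\<close> component_in[OF \<open>z \<in> space ?P\<close> that]]
          abs_integral_le_bound[OF prob_space_axioms g_m g_b[OF \<open>p \<in> E\<close>]]]] by simp
    then have "\<bar>\<Sum>j<m. g p (z j) - (\<integral>y. g p y \<partial>M)\<bar> \<le> real (card {..<m}) * (2 * ((1 / real m) * b))"
      by (intro order_trans[OF sum_abs] sum_bounded_above) auto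
    then show ?thesis by simp
  qed
  have \<phi>_m [measurable]: "\<phi> \<in> borel_measurable borel"
    unfolding \<phi>_def by measurable
  have \<phi>t: "\<phi> (t A y) = (1 / real m) * pos_part (1 - (1 / r) * (A \<bullet> outer (u y) w))" for A y
    using m_pos by (simp add: \<phi>_def t_def)
  have \<phi>t_b: "\<bar>\<phi> (t A y)\<bar> \<le> (1 / real m) * (1 + b / r)" if "A \<in> D" "y \<in> space M" for A y
    unfolding \<phi>t abs_mult using D(3) that by (intro mult_mono abs_pop_term_le) auto
  have \<phi>t_m: "(\<lambda>y. \<phi> (t A y)) \<in> borel_measurable M" for A
    by (intro measurable_compose[OF t_m \<phi>_m])
  have W_term: "\<bar>\<Sum>j<m. \<phi> (t A (z j)) - (\<integral>y. \<phi> (t A y) \<partial>M)\<bar> \<le> real m * (2 * ((1 / real m) * (1 + b / r)))"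
    if "A \<in> D" "z \<in> space ?P" for A z
  proof -
    have "\<bar>\<phi> (t A (z j)) - (\<integral>y. \<phi> (t A y) \<partial>M)\<bar> \<le> 2 * ((1 / real m) * (1 + b / r))" if "j < m" for j
      using order_trans[OF abs_triangle_ineq4 add_mono[OF \<phi>t_b[OF \<open>A \<in> D\<close> component_in[OF \<open>z \<in> space ?P\<close> that]]
          abs_integral_le_bound[OF prob_space_axioms \<phi>t_m \<phi>t_b[OF \<open>A \<in> D\<close>]]]] by simp
    then have "\<bar>\<Sum>j<m. \<phi> (t A (z j)) - (\<integral>y. \<phi> (t A y) \<partial>M)\<bar>
        \<le> real (card {..<m}) * (2 * ((1 / real m) * (1 + b / r)))"
      by (intro order_trans[OF sum_abs] sum_bounded_above) auto
    then show ?thesis by simp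
  qed
  have V_int: "integrable ?P V"
    unfolding V_def
  proof (rule integrable_bounded[OF prob_space_sample])
    show "(\<lambda>z. SUP p\<in>E. \<Sum>j<m. g p (z j) - (\<integral>y. g p y \<partial>M)) \<in> borel_measurable ?P"
      by (rule cSUP_measurable_bounded[OF E(1) _ V_term])
        (auto intro!: borel_measurable_sum borel_measurable_diff measurable_compose[OF _ g_m])
  qed (rule abs_cSUP_le[OF E_ne V_term])
  have W_int: "integrable ?P W"
    unfolding W_def
  proof (rule integrable_bounded[OF prob_space_sample])
    show "(\<lambda>z. SUP A\<in>D. \<Sum>j<m. \<phi> (t A (z j)) - (\<integral>y. \<phi> (t A y) \<partial>M)) \<in> borel_measurable ?P"
      by (rule cSUP_measurable_bounded[OF D(1) _ W_term])
        (auto intro!: borel_measurable_sum borel_measurable_diff measurable_compose[OF _ \<phi>t_m])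
  qed (rule abs_cSUP_le[OF D(2) W_term])
  have F_int: "integrable ?P (\<lambda>z. SUP A\<in>D. emp z A - pop A)"
  proof (rule integrable_bounded[OF prob_space_sample])
    have gap: "\<bar>emp z A - pop A\<bar> \<le> 2 * (1 + b / r)" if "A \<in> D" "z \<in> space ?P" for A z
      using abs_gap_le[of A z] D(3) that by auto
    show "(\<lambda>z. SUP A\<in>D. emp z A - pop A) \<in> borel_measurable ?P"
      by (rule cSUP_measurable_bounded[OF D(1) _ gap])
        (intro borel_measurable_diff emp_measurable borel_measurable_const)
    show "\<bar>SUP A\<in>D. emp z A - pop A\<bar> \<le> 2 * (1 + b / r)" if "z \<in> space ?P" for z
      by (rule abs_cSUP_le[OF D(2) gap[OF _ that]])
  qed
  have pointwise: "(SUP A\<in>D. emp z A - pop A) \<le> (1 / r) * V z + W z" if z: "z \<in> space ?P" for z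
  proof (rule cSUP_least[OF D(2)])
    fix A assume "A \<in> D"
    then have A: "A \<in> H" using D by auto
    \<comment> \<open>The error of the inner sample average. It depends on every sample point, so it
      is controlled against all \<open>y\<close> in \<open>U\<close> simultaneously before a sample
      point is inserted for \<open>y\<close>.\<close>
    define v where "v = (1 / real m) *\<^sub>R (\<Sum>j<m. u (z j)) - w"
    have mean: "(1 / real m) * (\<Sum>j<m. A' \<bullet> outer y (u (z j))) = A' \<bullet> outer y v + A' \<bullet> outer y w" for A' y
      by (simp add: v_def outer.diff_right inner_diff_right outer.scaleR_right outer.sum_right inner_sum_right)
    have v_le: "A \<bullet> outer y v \<le> V z" if y: "y \<in> U" for y
    proof -
      have "(A, y) \<in> closure E" using A y E(3) by auto
      then obtain p where p: "\<And>n. p n \<in> E" "p \<longlonglongrightarrow> (A, y)"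
        by (auto simp: closure_sequential)
      have "fst (p n) \<bullet> outer (snd (p n)) v \<le> V z" for n
      proof -
        have "fst (p n) \<bullet> outer (snd (p n)) v = (\<Sum>j<m. g (p n) (z j) - (\<integral>y. g (p n) y \<partial>M))"
          using mean[of "fst (p n)" "snd (p n)"] m_pos
          by (simp add: g_def sum_subtractf inner_outer_w[symmetric] sum_distrib_left[symmetric] sum_divide_distrib[symmetric])
        also have "\<dots> \<le> V z"
          unfolding V_def by (rule cSUP_upper[OF p(1) bdd_above_abs]) (rule V_term[OF _ z])
        finally show ?thesis .
      qed
      moreover have "(\<lambda>n. fst (p n) \<bullet> outer (snd (p n)) v) \<longlonglongrightarrow> fst (A, y) \<bullet> outer (snd (A, y)) v"
        by (intro tendsto_inner outer.tendsto tendsto_fst tendsto_snd p tendsto_const)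
      ultimately show ?thesis by (intro LIMSEQ_le_const2) auto
    qed
    \<comment> \<open>The one-sided supremum \<open>V z\<close> bounds the absolute value because
      \<open>- y\<close> belongs to \<open>U\<close> as well.\<close>
    have abs_v_le: "\<bar>A \<bullet> outer y v\<bar> \<le> V z" if "y \<in> U" for y
      using v_le[OF that] v_le[OF uminus_U[OF that]] by (simp add: outer.minus_left abs_le_iff)
    have "emp z A = (1 / real m) * (\<Sum>i<m. pos_part (1 - (1 / r) * (A \<bullet> outer (u (z i)) v + A \<bullet> outer (u (z i)) w)))"
      unfolding emp_def mean[symmetric] by (simp add: mult.commute)
    also have "\<dots> \<le> (1 / real m) * (\<Sum>i<m. (1 / r) * V z + pos_part (1 - (1 / r) * (A \<bullet> outer (u (z i)) w)))"
    proof (intro mult_left_mono sum_mono)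
      fix i assume "i \<in> {..<m}"
      then have ui: "u (z i) \<in> U" using u_in component_in[OF z] by auto
      let ?s = "A \<bullet> outer (u (z i)) v" and ?t = "A \<bullet> outer (u (z i)) w"
      \<comment> \<open>Replacing the inner sample average by \<open>w\<close> costs at most
        \<open>\<bar>?s\<bar> / r\<close>, as the hinge is 1-Lipschitz. No contraction inequality is
        involved in this half.\<close>
      have "pos_part (1 - (1 / r) * (?s + ?t)) - pos_part (1 - (1 / r) * ?t)
          \<le> \<bar>(1 - (1 / r) * (?s + ?t)) - (1 - (1 / r) * ?t)\<bar>"
        using pos_part_lipschitz abs_le_D1 by blast
      also have "\<dots> = (1 / r) * \<bar>?s\<bar>"
        using r_pos by (simp add: ring_distribs abs_mult)
      also have "\<dots> \<le> (1 / r) * V z"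
        using r_pos by (intro mult_left_mono abs_v_le[OF ui]) auto
      finally show "pos_part (1 - (1 / r) * (?s + ?t)) \<le> (1 / r) * V z + pos_part (1 - (1 / r) * ?t)"
        by simp
    qed simp
    also have "\<dots> = (1 / r) * V z + (\<Sum>i<m. \<phi> (t A (z i)))"
      using m_pos by (simp add: \<phi>t sum.distrib distrib_left sum_distrib_left)
    finally have "emp z A - pop A \<le> (1 / r) * V z + ((\<Sum>i<m. \<phi> (t A (z i))) - pop A)"
      by simp
    also have "(\<Sum>i<m. \<phi> (t A (z i))) - pop A = (\<Sum>i<m. \<phi> (t A (z i)) - (\<integral>y. \<phi> (t A y) \<partial>M))"
      using m_pos by (simp add: \<phi>t pop_def sum_subtractf)
    also have "\<dots> \<le> W z"
      unfolding W_def by (rule cSUP_upper[OF \<open>A \<in> D\<close> bdd_above_abs]) (rule W_term[OF _ z])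
    finally show "emp z A - pop A \<le> (1 / r) * V z + W z" by simp
  qed
  have "(\<integral>z. (SUP A\<in>D. emp z A - pop A) \<partial>?P) \<le> (\<integral>z. (1 / r) * V z + W z \<partial>?P)"
    using V_int W_int by (intro integral_mono F_int pointwise) auto
  also have "\<dots> = (1 / r) * (\<integral>z. V z \<partial>?P) + (\<integral>z. W z \<partial>?P)"
    using V_int W_int by simp
  also have "\<dots> \<le> (1 / r) * (2 * rad) + (2 / r) * rad"
    using r_pos by (intro add_mono mult_left_mono V_le W_le) auto
  also have "\<dots> = 4 / r * rad" by simp
  finally show ?thesis .
qed

theorem uniform_deviation:
  assumes \<delta>: "0 < \<delta>" "\<delta> < 1"
  obtains S where "S \<in> sets (PiM {..<m} (\<lambda>_. M))" "measure (PiM {..<m} (\<lambda>_. M)) S \<ge> 1 - \<delta>"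
    "\<And>z A. z \<in> S \<Longrightarrow> A \<in> H \<Longrightarrow>
      emp z A - pop A \<le> 4 / r * rad + 2 * b / r * sqrt (2 * ln (1 / \<delta>) / real m)"
proof -
  let ?P = "PiM {..<m} (\<lambda>_. M)"
  interpret P: prob_space ?P by (rule prob_space_sample)
  obtain D where D: "countable D" "D \<subseteq> H" "H \<subseteq> closure D"
    using separable by blast
  have D_ne: "D \<noteq> {}" using D(3) H_nonempty by auto
  define F where "F z = (SUP A\<in>D. emp z A - pop A)" for z
  have gap: "\<bar>emp z A - pop A\<bar> \<le> 2 * (1 + b / r)" if "A \<in> D" "z \<in> space ?P" for A z
    using abs_gap_le[of A z] D(2) that by auto
  have F_m [measurable]: "F \<in> borel_measurable ?P"
    unfolding F_def by (rule cSUP_measurable_bounded[OF D(1) _ gap])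
      (intro borel_measurable_diff emp_measurable borel_measurable_const)
  have F_b: "\<bar>F z\<bar> \<le> 2 * (1 + b / r)" if "z \<in> space ?P" for z
    unfolding F_def by (rule abs_cSUP_le[OF D_ne gap[OF _ that]])
  have F_upper: "emp z A - pop A \<le> F z" if "A \<in> D" "z \<in> space ?P" for A z
    unfolding F_def by (rule cSUP_upper[OF that(1) bdd_above_abs]) (rule gap[OF _ that(2)])
  define c where "c = 4 * b / (real m * r)"
  have c: "c > 0" using b_pos m_pos r_pos by (simp add: c_def)
  have F_diff: "F (z(k := x)) - F z \<le> c" if "z \<in> space ?P" "k \<in> {..<m}" "x \<in> space M" for z k x
  proof -
    have "F (z(k := x)) \<le> F z + c"
      unfolding F_def[of "z(k := x)"]
    proof (rule cSUP_least[OF D_ne])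
      fix A assume A: "A \<in> D"
      have "emp (z(k := x)) A - emp z A \<le> c"
        unfolding c_def using A D(2) that by (intro emp_bounded_difference) auto
      then show "emp (z(k := x)) A - pop A \<le> F z + c"
        using F_upper[OF A that(1)] by linarith
    qed
    then show ?thesis by simp
  qed
  \<comment> \<open>The deviation at which the tail
    \<open>exp (- 2 * \<tau>\<^sup>2 / (m * c\<^sup>2))\<close> equals \<open>\<delta>\<close>,
    given \<open>c = 4 * b / (m * r)\<close>.\<close>
  define \<tau> where "\<tau> = 2 * b / r * sqrt (2 * ln (1 / \<delta>) / real m)"
  have ln_pos: "ln (1 / \<delta>) > 0" using \<delta> by simp
  have \<tau>: "\<tau> > 0" using b_pos r_pos m_pos ln_pos by (simp add: \<tau>_def)
  define \<mu> where "\<mu> = (\<integral>z. F z \<partial>?P)"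
  have "P.prob {z \<in> space ?P. F z \<ge> \<mu> + \<tau>} \<le> exp (- 2 * \<tau>\<^sup>2 / (real (card {..<m}) * c\<^sup>2))"
    unfolding \<mu>_def using m_pos
    by (intro bounded_differences_inequality[OF prob_space_axioms _ _ c \<tau> F_m F_b F_diff]) auto
  also have "- 2 * \<tau>\<^sup>2 / (real (card {..<m}) * c\<^sup>2) = - ln (1 / \<delta>)"
  proof -
    have "\<tau>\<^sup>2 = 4 * b\<^sup>2 / r\<^sup>2 * (2 * ln (1 / \<delta>) / real m)"
      using ln_pos by (simp add: \<tau>_def power_mult_distrib power_divide)
    then show ?thesis
      using b_pos r_pos m_pos by (simp add: c_def field_simps power2_eq_square)
  qed
  also have "exp (- ln (1 / \<delta>)) = \<delta>" using \<delta> by (simp add: ln_div)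
  finally have tail: "P.prob {z \<in> space ?P. F z \<ge> \<mu> + \<tau>} \<le> \<delta>" .
  show ?thesis
  proof
    \<comment> \<open>The event is defined by the supremum over the countable set \<open>D\<close>
      alone. It is thus measurable and serves all matrices of the class at once, whichever one a
      sample selects.\<close>
    show S: "{z \<in> space ?P. F z < \<mu> + \<tau>} \<in> sets ?P" by measurable
    have "{z \<in> space ?P. F z < \<mu> + \<tau>} = space ?P - {z \<in> space ?P. F z \<ge> \<mu> + \<tau>}" by auto
    then show "P.prob {z \<in> space ?P. F z < \<mu> + \<tau>} \<ge> 1 - \<delta>"
      using tail by (simp add: P.prob_compl)
    fix z A assume z: "z \<in> {z \<in> space ?P. F z < \<mu> + \<tau>}" and A: "A \<in> H"
    have zs: "z \<in> space ?P" using z by simp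
    have "emp z A - pop A \<le> F z"
      by (rule gap_le_of_dense[OF D(2) A subsetD[OF D(3) A] zs]) (rule F_upper[OF _ zs])
    moreover have "\<mu> \<le> 4 / r * rad"
      unfolding \<mu>_def F_def by (rule expected_sup_gap_le[OF D(1) D_ne D(2)])
    ultimately show "emp z A - pop A \<le> 4 / r * rad + 2 * b / r * sqrt (2 * ln (1 / \<delta>) / real m)"
      using z unfolding \<tau>_def by auto
  qed
qed

end

section \<open>Matrix norms and their duals\<close>

context
  fixes N :: "real^'d^'d \<Rightarrow> real"
  assumes N: "is_matrix_norm N"
begin

lemma matrix_norm_nonneg: "N A \<ge> 0" and matrix_norm_eq_0: "N A = 0 \<longleftrightarrow> A = 0"
  and matrix_norm_scale: "N (c *\<^sub>R A) = \<bar>c\<bar> * N A" and matrix_norm_triangle: "N (A + B) \<le> N A + N B"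
  using N by (auto simp: is_matrix_norm_def)

text \<open>A convex function on a finite-dimensional space is continuous, so \<open>N\<close>
  attains a minimum on the Euclidean unit sphere; definiteness makes it positive and homogeneity
  extends the bound. The unit ball of \<open>N\<close> is then bounded, which keeps the suprema in
  the dual norms finite.\<close>

lemma matrix_norm_equivalence: obtains c where "c > 0" "\<And>A. norm A \<le> c * N A"
proof -
  have "convex_on UNIV N"
  proof (rule convex_onI)
    fix t :: real and A B :: "real^'d^'d"
    assume "0 < t" "t < 1"
    then show "N ((1 - t) *\<^sub>R A + t *\<^sub>R B) \<le> (1 - t) * N A + t * N B"
      using matrix_norm_triangle[of "(1 - t) *\<^sub>R A" "t *\<^sub>R B"] by (simp add: matrix_norm_scale)
  qed simp
  then have "continuous_on (sphere 0 1) N"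
    using continuous_on_subset[OF convex_on_continuous[OF open_UNIV]] by blast
  moreover have "sphere (0 :: real^'d^'d) 1 \<noteq> {}" by simp
  ultimately obtain A0 where A0: "A0 \<in> sphere 0 1" "\<And>A. A \<in> sphere 0 1 \<Longrightarrow> N A0 \<le> N A"
    using continuous_attains_inf[OF compact_sphere] by metis
  have pos: "N A0 > 0"
    using A0(1) matrix_norm_nonneg[of A0] matrix_norm_eq_0[of A0] by (auto simp: less_le)
  have "norm A \<le> (1 / N A0) * N A" for A
  proof (cases "A = 0")
    case False
    then have "N A0 \<le> N ((1 / norm A) *\<^sub>R A)" by (intro A0(2)) simp
    then show ?thesis using pos False by (simp add: matrix_norm_scale field_simps)
  qed (use pos matrix_norm_nonneg in simp)
  with pos show thesis by (intro that[of "1 / N A0"]) auto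
qed

lemma inner_le_norm: obtains c where "c > 0" "\<And>A B. N A \<le> 1 \<Longrightarrow> A \<bullet> B \<le> c * norm B"
proof -
  obtain c where c: "c > 0" "\<And>A. norm A \<le> c * N A" using matrix_norm_equivalence by blast
  have "A \<bullet> B \<le> c * norm B" if "N A \<le> 1" for A B
  proof -
    have "norm A \<le> c"
      using c(2)[of A] mult_left_mono[OF that, of c] c(1) by linarith
    then have "norm A * norm B \<le> c * norm B" by (intro mult_right_mono) auto
    then show ?thesis using norm_cauchy_schwarz[of A B] by simp
  qed
  with c(1) show thesis by (rule that)
qed

text \<open>A real \<open>Sup\<close> has its meaning only for nonempty sets bounded above. Both
  conditions are discharged here, and the later arguments use the dual norm through these two
  rules.\<close>

lemma inner_le_dual_norm: "N A \<le> 1 \<Longrightarrow> A \<bullet> B \<le> dual_norm N B"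
  and dual_norm_least: "(\<And>A. N A \<le> 1 \<Longrightarrow> A \<bullet> B \<le> t) \<Longrightarrow> dual_norm N B \<le> t"
proof -
  have eq: "dual_norm N B = (SUP A\<in>{A. N A \<le> 1}. A \<bullet> B)"
    unfolding dual_norm_def trace_eq_inner by (rule arg_cong[where f = Sup]) (auto simp: inner_commute)
  obtain c where c: "\<And>A B. N A \<le> 1 \<Longrightarrow> A \<bullet> B \<le> c * norm B" using inner_le_norm by blast
  have "bdd_above ((\<lambda>A. A \<bullet> B) ` {A. N A \<le> 1})"
    using c by (intro bdd_aboveI2) auto
  then show "N A \<le> 1 \<Longrightarrow> A \<bullet> B \<le> dual_norm N B"
    unfolding eq by (intro cSUP_upper) auto
  have "{A. N A \<le> 1} \<noteq> {}" using matrix_norm_eq_0[of 0] by (auto intro!: exI[of _ 0])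
  then show "(\<And>A. N A \<le> 1 \<Longrightarrow> A \<bullet> B \<le> t) \<Longrightarrow> dual_norm N B \<le> t"
    unfolding eq by (intro cSUP_least) auto
qed

lemma dual_norm_le_norm: obtains c where "c > 0" "\<And>B. dual_norm N B \<le> c * norm B"
  using inner_le_norm dual_norm_least by metis

lemma inner_le_scaled:
  assumes "c > 0" "N A \<le> c" "\<And>A'. N A' \<le> 1 \<Longrightarrow> A' \<bullet> B \<le> t"
  shows "A \<bullet> B \<le> c * t"
proof -
  have "N ((1 / c) *\<^sub>R A) \<le> 1" using assms(1,2) by (simp add: matrix_norm_scale field_simps)
  from assms(3)[OF this] show ?thesis using assms(1) by (simp add: field_simps)
qed

section \<open>Dual norms of outer products over a bounded set of points\<close>

context
  fixes X :: "(real^'d) set"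
  assumes X: "bounded X" "X \<noteq> {}"
begin

text \<open>This is the supremum under the expectation in \<open>rad_complexity\<close>, as a
  function of the signed sample average alone. Separating it reduces the measurability of that
  integrand to continuity in one vector.\<close>

definition sup_dual_outer :: "real^'d \<Rightarrow> real" where
  "sup_dual_outer v = Sup {dual_norm N (outer v x) | x. x \<in> X}"

lemma dual_outer_le_norm: 
  obtains c where "c \<ge> 0" "\<And>v x. x \<in> X \<Longrightarrow> dual_norm N (outer v x) \<le> c * norm v"
proof -
  obtain c where c: "c > 0" "\<And>B. dual_norm N B \<le> c * norm B" using dual_norm_le_norm by blast
  obtain R where R: "R > 0" "\<And>x. x \<in> X \<Longrightarrow> norm x \<le> R" using X(1) by (auto simp: bounded_pos)
  obtain k where k: "k > 0" "\<And>v x :: real^'d. norm (outer v x) \<le> norm v * norm x * k"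
    using bounded_bilinear.pos_bounded[OF bounded_bilinear_outer] by blast
  have "dual_norm N (outer v x) \<le> (c * k * R) * norm v" if "x \<in> X" for v x
  proof -
    have "norm v * norm x * k \<le> norm v * R * k"
      using R(2)[OF that] k(1) by (intro mult_left_mono mult_right_mono) auto
    then have "c * norm (outer v x) \<le> c * (norm v * R * k)"
      using k(2)[of v x] c(1) by (intro mult_left_mono) auto
    then show ?thesis using c(2)[of "outer v x"] by (simp add: mult_ac)
  qed
  then show thesis using c(1) R(1) k(1) by (intro that[of "c * k * R"]) auto
qed

lemma inner_le_sup_dual_outer: "N A \<le> 1 \<Longrightarrow> x \<in> X \<Longrightarrow> A \<bullet> outer v x \<le> sup_dual_outer v"
  and sup_dual_outer_least:
    "(\<And>A x. N A \<le> 1 \<Longrightarrow> x \<in> X \<Longrightarrow> A \<bullet> outer v x \<le> t) \<Longrightarrow> sup_dual_outer v \<le> t"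
proof -
  have eq: "sup_dual_outer v = (SUP x\<in>X. dual_norm N (outer v x))"
    unfolding sup_dual_outer_def by (rule arg_cong[where f = Sup]) auto
  obtain c where c: "c \<ge> 0" "\<And>v x. x \<in> X \<Longrightarrow> dual_norm N (outer v x) \<le> c * norm v"
    using dual_outer_le_norm by blast
  have bdd: "bdd_above ((\<lambda>x. dual_norm N (outer v x)) ` X)"
    using c(2) by (intro bdd_aboveI2) auto
  show "A \<bullet> outer v x \<le> sup_dual_outer v" if "N A \<le> 1" "x \<in> X"
    unfolding eq by (rule order_trans[OF inner_le_dual_norm[OF that(1)] cSUP_upper[OF that(2) bdd]])
  show "(\<And>A x. N A \<le> 1 \<Longrightarrow> x \<in> X \<Longrightarrow> A \<bullet> outer v x \<le> t) \<Longrightarrow> sup_dual_outer v \<le> t"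
    unfolding eq by (intro cSUP_least X dual_norm_least) auto
qed

lemma sup_dual_outer_nonneg: "0 \<le> sup_dual_outer v"
  using inner_le_sup_dual_outer[of 0] matrix_norm_eq_0[of 0] X(2) by force

lemma sup_dual_outer_le_norm: obtains c where "c \<ge> 0" "\<And>v. sup_dual_outer v \<le> c * norm v"
proof -
  obtain c where c: "c \<ge> 0" "\<And>v x. x \<in> X \<Longrightarrow> dual_norm N (outer v x) \<le> c * norm v"
    using dual_outer_le_norm by blast
  have "sup_dual_outer v \<le> c * norm v" for v
    by (rule sup_dual_outer_least) (rule order_trans[OF inner_le_dual_norm c(2)])
  with c(1) show thesis by (rule that)
qed

text \<open>A finite supremum of functions linear in \<open>v\<close> is convex, hence continuous on
  a finite-dimensional space. Borel measurability follows even though the supremum runs over an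
  uncountable set of points.\<close>

lemma continuous_sup_dual_outer: "continuous_on UNIV sup_dual_outer"
proof (rule convex_on_continuous[OF open_UNIV], rule convex_onI)
  fix t :: real and v v' :: "real^'d"
  assume t: "0 < t" "t < 1"
  show "sup_dual_outer ((1 - t) *\<^sub>R v + t *\<^sub>R v') \<le> (1 - t) * sup_dual_outer v + t * sup_dual_outer v'"
  proof (rule sup_dual_outer_least)
    fix A x assume Ax: "N A \<le> 1" "x \<in> X"
    have "A \<bullet> outer ((1 - t) *\<^sub>R v + t *\<^sub>R v') x = (1 - t) * (A \<bullet> outer v x) + t * (A \<bullet> outer v' x)"
      by (simp add: outer.add_left outer.scaleR_left inner_add_right)
    also have "\<dots> \<le> (1 - t) * sup_dual_outer v + t * sup_dual_outer v'"
      using t by (intro add_mono mult_left_mono inner_le_sup_dual_outer Ax) auto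
    finally show "A \<bullet> outer ((1 - t) *\<^sub>R v + t *\<^sub>R v') x
        \<le> (1 - t) * sup_dual_outer v + t * sup_dual_outer v'" .
  qed
qed simp

lemma inner_le_X_star: 
  assumes "N A \<le> 1" "x \<in> X" "x' \<in> X" shows "A \<bullet> outer x x' \<le> X_star N X"
proof -
  obtain c where c: "c \<ge> 0" "\<And>v x. x \<in> X \<Longrightarrow> dual_norm N (outer v x) \<le> c * norm v"
    using dual_outer_le_norm by blast
  obtain R where R: "\<And>x. x \<in> X \<Longrightarrow> norm x \<le> R" using X(1) by (auto simp: bounded_iff)
  have "bdd_above {dual_norm N (outer x' x) | x x'. x \<in> X \<and> x' \<in> X}"
  proof (rule bdd_aboveI)
    fix y assume "y \<in> {dual_norm N (outer x' x) | x x'. x \<in> X \<and> x' \<in> X}"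
    then show "y \<le> c * R" using order_trans[OF c(2) mult_left_mono[OF R c(1)]] by blast
  qed
  then have "dual_norm N (outer x x') \<le> X_star N X"
    unfolding X_star_def using assms(2,3) by (intro cSup_upper) auto
  with inner_le_dual_norm[OF assms(1)] show ?thesis by (rule order_trans)
qed

text \<open>Testing the dual norm of \<open>outer x x\<close> with the normalized matrix
  \<open>outer x x\<close> itself gives a positive value. This yields \<open>b > 0\<close>, and with
  it the positive step size and deviation in the bounded differences inequality.\<close>

lemma X_star_pos:
  assumes "x \<in> X" "x \<noteq> 0" shows "X_star N X > 0"
proof -
  let ?B = "outer x x"
  obtain i where "x $ i \<noteq> 0" using assms(2) by (auto simp: vec_eq_iff)
  then have "?B $ i $ i \<noteq> 0" by (simp add: outer_def)
  then have B: "?B \<noteq> 0" by auto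
  then have N_pos: "N ?B > 0" using matrix_norm_nonneg[of ?B] matrix_norm_eq_0[of ?B] by (simp add: less_le)
  have "((1 / N ?B) *\<^sub>R ?B) \<bullet> ?B \<le> X_star N X"
    by (rule inner_le_X_star) (use N_pos assms in \<open>simp_all add: matrix_norm_scale\<close>)
  moreover have "((1 / N ?B) *\<^sub>R ?B) \<bullet> ?B > 0" using N_pos B by simp
  ultimately show ?thesis by simp
qed

end
end

section \<open>Instantiation for the regularized minimizer\<close>

theorem theorem1:
  fixes X :: "(real^'d) set"
    and \<rho> :: "((real^'d) \<times> real) measure"
    and N :: "real^'d^'d \<Rightarrow> real"
    and Az :: "(nat \<Rightarrow> (real^'d) \<times> real) \<Rightarrow> real^'d^'d"
    and m :: nat and r lam \<delta> :: real
  assumes "bounded X" and "open X" and "connected X" and "X \<noteq> {}"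
    and "prob_space \<rho>" and "sets \<rho> = sets borel"
    and "AE z in \<rho>. fst z \<in> X \<and> snd z \<in> {-1, 1}"
    and "m > 0" and "r > 0" and "lam > 0"
    and "is_matrix_norm N"
    and "\<forall>z\<in>space (sample_measure m \<rho>). transpose (Az z) = Az z \<and>
           (\<forall>A. transpose A = A \<longrightarrow>
              emp_err r m z (Az z) + lam * N (Az z) \<le> emp_err r m z A + lam * N A)"
    and "0 < \<delta>" and "\<delta> < 1"
  shows "\<exists>S\<in>sets (sample_measure m \<rho>). measure (sample_measure m \<rho>) S \<ge> 1 - \<delta> \<and>
           (\<forall>z\<in>S. emp_err r m z (Az z) - exp_err \<rho> r (Az z)
              \<le> 6 * rad_complexity \<rho> N X m / (r * lam)
                + 2 * X_star N X / (r * lam) * sqrt (2 * ln (1 / \<delta>) / real m))"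
proof -
  note N = assms(11) and X = assms(1,4) and min = assms(12)
  interpret prob_space \<rho> by fact
  have sets_\<rho> [measurable_cong]: "sets \<rho> = sets borel" by fact
  have space_\<rho>: "space \<rho> = UNIV" using sets_eq_imp_space_eq[OF sets_\<rho>] by simp
  obtain x0 where x0: "x0 \<in> X" using X(2) by auto
  define G where "G = {z :: (real^'d) \<times> real. fst z \<in> X \<and> snd z \<in> {-1, 1}}"
  have [measurable]: "X \<in> sets borel" using assms(2) by simp
  have G_sets [measurable]: "G \<in> sets borel"
  proof -
    have "G = X \<times> {-1, 1}" by (auto simp: G_def)
    then show ?thesis by (simp add: borel_prod[symmetric])
  qed
  have [measurable]: "fst \<in> borel_measurable (borel :: ((real^'d) \<times> real) measure)"
    "snd \<in> borel_measurable (borel :: ((real^'d) \<times> real) measure)"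
    by (intro borel_measurable_continuous_onI continuous_intros)+
  have AE_G: "AE z in \<rho>. z \<in> G" using assms(7) by (simp add: G_def)
  \<comment> \<open>The support condition holds only almost everywhere, whereas the locale asks for
    \<open>u z \<in> U\<close> at every point. The value \<open>x0\<close> off \<open>G\<close>
    repairs this on a null set.\<close>
  define u where "u z = (if z \<in> G then snd z *\<^sub>R fst z else x0)" for z
  define U where "U = X \<union> uminus ` X"
  define H where "H = {A :: real^'d^'d. transpose A = A \<and> N A \<le> 1 / lam}"
  \<comment> \<open>The factor \<open>1 / lam\<close> is the radius of \<open>H\<close>; it passes
    into \<open>S.rad\<close> and accounts for the \<open>lam\<close> in both denominators of the
    final bound.\<close>
  define q where "q v = (1 / lam) * sup_dual_outer N X v" for v
  have sup_m [measurable]: "sup_dual_outer N X \<in> borel_measurable borel"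
    by (rule borel_measurable_continuous_onI[OF continuous_sup_dual_outer[OF N X]])
  obtain c where c: "c \<ge> 0" "\<And>v. sup_dual_outer N X v \<le> c * norm v"
    using sup_dual_outer_le_norm[OF N X] by blast
  have lam_inv: "1 / lam > 0" using assms(10) by simp
  \<comment> \<open>A nonempty open set cannot be \<open>{0}\<close>, so \<open>X\<close> has a
    nonzero point, as required for the positivity of \<open>X_star\<close>.\<close>
  obtain x1 where x1: "x1 \<in> X" "x1 \<noteq> 0"
    using assms(2) X(2) not_open_singleton[of "0 :: real^'d"] by (metis singletonI subsetI subset_singletonD)
  have N_minus: "N (- A) = N A" for A
    using matrix_norm_scale[OF N, of "-1" A] by simp
  \<comment> \<open>The bound for \<open>- B\<close> serves the reflected half of \<open>U\<close>;
    it holds because \<open>- A\<close> has the same norm as \<open>A\<close>.\<close>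
  have le_pm: "A \<bullet> B \<le> (1 / lam) * t" "A \<bullet> (- B) \<le> (1 / lam) * t"
    if "A \<in> H" "\<And>A'. N A' \<le> 1 \<Longrightarrow> A' \<bullet> B \<le> t" for A B t
    using inner_le_scaled[OF N lam_inv _ that(2), of A] inner_le_scaled[OF N lam_inv _ that(2), of "- A"]
      that(1) by (auto simp: H_def N_minus)
  interpret S: similarity_class \<rho> u H U "X_star N X / lam" "c / lam" r q m
  proof
    show "u \<in> borel_measurable \<rho>"
      unfolding u_def by measurable
    show "u z \<in> U" for z using x0 by (auto simp: u_def G_def U_def)
    show "bounded U" using X(1) by (simp add: U_def bounded_minus_comp image_comp)
    show "- v \<in> U" if "v \<in> U" for v using that by (auto simp: U_def)
    have "0 \<in> H" using matrix_norm_eq_0[OF N, of 0] assms(10) by (simp add: H_def transpose_def vec_eq_iff)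
    then show "H \<noteq> {}" by auto
    show "transpose A = A" if "A \<in> H" for A using that by (simp add: H_def)
    show "A \<bullet> outer v v' \<le> X_star N X / lam" if "A \<in> H" "v \<in> U" "v' \<in> U" for A v v'
      using le_pm[OF that(1) inner_le_X_star[OF N X]] that(2,3)
      by (auto simp: U_def outer.minus_left outer.minus_right)
    show "A \<bullet> outer v v' \<le> q v" if "A \<in> H" "v' \<in> U" for A v v'
      using le_pm[OF that(1) inner_le_sup_dual_outer[OF N X]] that(2)
      by (auto simp: U_def q_def outer.minus_right)
    show "q \<in> borel_measurable borel"
      unfolding q_def by measurable
    show "0 \<le> q v" for v
      using sup_dual_outer_nonneg[OF N X] assms(10) by (simp add: q_def)
    show "q v \<le> c / lam * norm v" for v
      using c(2)[of v] assms(10) by (simp add: q_def divide_right_mono)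
    show "0 < X_star N X / lam" using X_star_pos[OF N X x1] assms(10) by simp
    show "0 \<le> c / lam" using c(1) assms(10) by simp
  qed fact+
  let ?P = "PiM {..<m} (\<lambda>_. \<rho>)"
  interpret P: prob_space ?P by (rule S.prob_space_sample)
  have AE_sample: "AE z in ?P. \<forall>i<m. z i \<in> G"
  proof -
    have "AE z in ?P. \<forall>i\<in>{..<m}. z i \<in> G"
      by (intro AE_finite_allI) (auto intro!: AE_PiM_component prob_space_axioms AE_G)
    then show ?thesis by (rule eventually_mono) auto
  qed
  have kerA_u: "snd z * snd z' * kerA A (fst z) (fst z') = A \<bullet> outer (u z) (u z')"
    if "z \<in> G" "z' \<in> G" for z z' A
    using that by (simp add: u_def kerA_eq_inner outer.scaleR_left outer.scaleR_right mult_ac)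
  have emp: "emp_err r m z A = S.emp z A" if "\<And>i. i < m \<Longrightarrow> z i \<in> G" for z A
    unfolding emp_err_def S.emp_def using that by (simp add: kerA_u)
  have pop: "exp_err \<rho> r A = S.pop A" for A
    unfolding exp_err_def S.pop_def
  proof (rule integral_cong_AE)
    show "AE z in \<rho>. pos_part (1 - 1 / r * (\<integral>z'. snd z * snd z' * kerA A (fst z) (fst z') \<partial>\<rho>))
        = pos_part (1 - 1 / r * (A \<bullet> outer (u z) S.w))"
      using AE_G
    proof eventually_elim
      case (elim z)
      have "(\<integral>z'. snd z * snd z' * kerA A (fst z) (fst z') \<partial>\<rho>) = (\<integral>z'. A \<bullet> outer (u z) (u z') \<partial>\<rho>)"
      proof (rule integral_cong_AE)
        show "AE z' in \<rho>. snd z * snd z' * kerA A (fst z) (fst z') = A \<bullet> outer (u z) (u z')"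
          using AE_G by eventually_elim (simp add: kerA_u[OF elim])
      qed (unfold kerA_eq_inner, measurable)
      then show ?case by (simp add: S.inner_outer_w)
    qed
  qed (unfold kerA_eq_inner, measurable)
  have rad: "S.rad = rad_complexity \<rho> N X m / lam"
  proof -
    have "rad_complexity \<rho> N X m = (\<integral>z. (\<Sum>\<sigma>\<in>{..<m} \<rightarrow>\<^sub>E {-1, 1}. sup_dual_outer N X (S.rad_arg \<sigma> z)) / 2 ^ m \<partial>?P)"
      unfolding rad_complexity_def sample_measure_def
    proof (rule integral_cong_AE)
      show "AE z in ?P. (\<Sum>\<sigma>\<in>{..<m} \<rightarrow>\<^sub>E {-1, 1}. Sup {dual_norm N (outer ((1 / real m) *\<^sub>R
          (\<Sum>i<m. (\<sigma> i * snd (z i)) *\<^sub>R fst (z i))) xt) | xt. xt \<in> X}) / 2 ^ m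
        = (\<Sum>\<sigma>\<in>{..<m} \<rightarrow>\<^sub>E {-1, 1}. sup_dual_outer N X (S.rad_arg \<sigma> z)) / 2 ^ m"
        using AE_sample
        by eventually_elim (simp add: sup_dual_outer_def[OF N X] u_def)
    next
      have comp: "(\<lambda>z. z i) \<in> measurable ?P \<rho>" if "i \<in> {..<m}" for i
        using measurable_component_singleton[OF that] .
      have fst_snd: "fst \<in> borel_measurable \<rho>" "snd \<in> borel_measurable \<rho>" by measurable
      show "(\<lambda>z. (\<Sum>\<sigma>\<in>{..<m} \<rightarrow>\<^sub>E {-1, 1}. Sup {dual_norm N (outer ((1 / real m) *\<^sub>R
          (\<Sum>i<m. (\<sigma> i * snd (z i)) *\<^sub>R fst (z i))) xt) | xt. xt \<in> X}) / 2 ^ m) \<in> borel_measurable ?P"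
        unfolding sup_dual_outer_def[OF N X, symmetric]
        by (intro borel_measurable_divide borel_measurable_sum measurable_compose[OF _ sup_m]
            borel_measurable_scaleR borel_measurable_times borel_measurable_const
            measurable_compose[OF comp fst_snd(1)] measurable_compose[OF comp fst_snd(2)])
      show "(\<lambda>z. (\<Sum>\<sigma>\<in>{..<m} \<rightarrow>\<^sub>E {-1, 1}. sup_dual_outer N X (S.rad_arg \<sigma> z)) / 2 ^ m) \<in> borel_measurable ?P"
        by (intro borel_measurable_divide borel_measurable_sum measurable_compose[OF S.rad_arg_measurable sup_m]
            borel_measurable_const)
    qed
    then show ?thesis by (simp add: S.rad_def q_def sum_divide_distrib[symmetric])
  qed
  obtain S where S: "S \<in> sets ?P" "P.prob S \<ge> 1 - \<delta>"
    "\<And>z A. z \<in> S \<Longrightarrow> A \<in> H \<Longrightarrow> S.emp z A - S.pop A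
      \<le> 4 / r * S.rad + 2 * (X_star N X / lam) / r * sqrt (2 * ln (1 / \<delta>) / real m)"
    using S.uniform_deviation[OF assms(13,14)] by blast
  \<comment> \<open>The population errors agree for every matrix, since null sets do not affect
    integrals. The empirical errors agree only when every sample point lies in \<open>G\<close>, so
    the event is cut down to this set of full measure.\<close>
  define T where "T = {z \<in> space ?P. \<forall>i<m. z i \<in> G}"
  have T: "T \<in> sets ?P" unfolding T_def by measurable
  show ?thesis
    unfolding sample_measure_def
  proof (intro bexI conjI ballI)
    show "S \<inter> T \<in> sets ?P" using S(1) T by auto
    have "P.prob (S \<inter> T) = P.prob S"
    proof (rule P.finite_measure_eq_AE)
      show "AE z in ?P. (z \<in> S \<inter> T) = (z \<in> S)"
        using AE_sample by (auto simp: T_def elim!: eventually_mono)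
    qed (use S(1) T in auto)
    with S(2) show "P.prob (S \<inter> T) \<ge> 1 - \<delta>" by simp
    fix z assume z: "z \<in> S \<inter> T"
    then have zP: "z \<in> space (sample_measure m \<rho>)" and zG: "\<And>i. i < m \<Longrightarrow> z i \<in> G"
      by (auto simp: T_def sample_measure_def)
    have sym: "transpose (Az z) = Az z" and
      opt: "emp_err r m z (Az z) + lam * N (Az z) \<le> emp_err r m z 0 + lam * N 0"
      using min zP by (auto simp: transpose_def vec_eq_iff)
    have "emp_err r m z 0 = 1"
      using assms(8) by (simp add: emp_err_def kerA_def pos_part_def)
    moreover have "emp_err r m z (Az z) \<ge> 0"
      unfolding emp_err_def by (intro mult_nonneg_nonneg sum_nonneg pos_part_bounds) auto
    ultimately have "lam * N (Az z) \<le> 1"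
      using opt matrix_norm_eq_0[OF N, of 0] by simp
    then have "Az z \<in> H"
      using sym assms(10) by (simp add: H_def field_simps)
    then have "emp_err r m z (Az z) - exp_err \<rho> r (Az z)
        \<le> 4 / r * S.rad + 2 * (X_star N X / lam) / r * sqrt (2 * ln (1 / \<delta>) / real m)"
      using S(3)[of z "Az z"] z by (simp add: emp[OF zG] pop)
    \<comment> \<open>The sharper constant 4 is relaxed to the stated 6, which is allowed since
      \<open>S.rad\<close> is nonnegative.\<close>
    also have "\<dots> \<le> 6 / r * S.rad + 2 * (X_star N X / lam) / r * sqrt (2 * ln (1 / \<delta>) / real m)"
      using assms(9) S.rad_nonneg by (intro add_right_mono mult_right_mono divide_right_mono) auto
    also have "\<dots> = 6 * rad_complexity \<rho> N X m / (r * lam)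
        + 2 * X_star N X / (r * lam) * sqrt (2 * ln (1 / \<delta>) / real m)"
      by (simp add: rad mult_ac)
    finally show "emp_err r m z (Az z) - exp_err \<rho> r (Az z) \<le> 6 * rad_complexity \<rho> N X m / (r * lam)
        + 2 * X_star N X / (r * lam) * sqrt (2 * ln (1 / \<delta>) / real m)" .
  qed
qed

end
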